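(* Let $k$ be a field, $n\ge2$, $Q=k[x_{i,j}\mid1\le i\le n,\ 1\le j\le n+1]$, and $R=Q/I_n$, where $I_n$ is the ideal of maximal minors of the generic $n\times(n+1)$ matrix $X=(x_{i,j})$. The minimal (graded) $Q$-free resolution of $\operatorname{coker}J^T_R$ is $$0\longrightarrow Q^{(n-1)(n+1)}\xrightarrow{\partial_2}Q^{n(n+1)}\xrightarrow{J^T_Q}Q^{n+1}\longrightarrow\operatorname{coker}J^T_R\longrightarrow0.$$
   Context: $F_r$ ($1\le r\le n+1$) is the determinant of the matrix obtained from $X$ by deleting column $r$; $I_n=(F_1,\dots,F_{n+1})$. $J^T_Q$ is the $(n+1)\times n(n+1)$ matrix with rows indexed by $F_1,\dots,F_{n+1}$, columns indexed by the variables in the order $x_{1,1},x_{1,2},\dots,x_{1,n+1},x_{2,1},\dots,x_{n,n+1}$, and $(i,(j,l))$-entry $\partial F_i/\partial x_{j,l}$; $J^T_R=J^T_Q\otimes_QR:R^{n(n+1)}\to R^{n+1}$. $\partial_2:Q^{(n-1)(n+1)}\to Q^{n(n+1)}$ is given by the block matrix whose first $n(n-1)$ columns form the block diagonal matrix $\operatorname{diag}(A_1,\dots,A_n)$, followed by the columns $B_2,\dots,B_n$. Here $A_k$ is the $(n+1)\times(n-1)$ matrix obtained from $X^T$ by removing the $k$th column, and $B_\ell=\sum_{s=1}^{n+1}\big(-x_{1,s}\vec e_s+x_{\ell,s}\vec e_{(\ell-1)(n+1)+s}\big)$, where $\vec e_m$ is the $m$th standard basis (column) vector of $Q^{n(n+1)}$.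 A graded free resolution over $Q$ is minimal if the matrices of its differentials have entries in the homogeneous maximal ideal of $Q$. *)

theory Defs
  imports
    "HOL-Library.Poly_Mapping"
    "HOL-Algebra.QuotRing"
    "Jordan_Normal_Form.Missing_VectorSpace"
    "Jordan_Normal_Form.Determinant"
begin

section \<open>Polynomial rings\<close>

text \<open>A monomial is a finitely supported exponent function and a polynomial a finitely supported
  coefficient function on monomials. The polynomial ring in a set \<open>V\<close> of variables consists of the
  polynomials all of whose monomials only involve variables from \<open>V\<close>.\<close>

type_synonym ('v, 'a) mpol = "('v \<Rightarrow>\<^sub>0 nat) \<Rightarrow>\<^sub>0 'a"

definition mpol_ring :: "'v set \<Rightarrow> ('v, 'a::comm_ring_1) mpol ring" where
  "mpol_ring V = \<lparr>carrier = {p. \<forall>m\<in>Poly_Mapping.keys p. Poly_Mapping.keys m \<subseteq> V},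
     monoid.mult = (*), one = 1, zero = 0, add = (+)\<rparr>"

definition mvar :: "'v \<Rightarrow> ('v, 'a::comm_ring_1) mpol" where
  "mvar v = Poly_Mapping.single (Poly_Mapping.single v 1) 1"

text \<open>The exponent subtraction truncates, but only where the coefficient vanishes.\<close>

definition partial_deriv :: "'v \<Rightarrow> ('v, 'a::comm_ring_1) mpol \<Rightarrow> ('v, 'a) mpol" where
  "partial_deriv v p = (\<Sum>m\<in>Poly_Mapping.keys p.
     Poly_Mapping.single (m - Poly_Mapping.single v 1)
       (of_nat (Poly_Mapping.lookup m v) * Poly_Mapping.lookup p m))"

definition monom_degree :: "('v \<Rightarrow>\<^sub>0 nat) \<Rightarrow> nat" where
  "monom_degree m = (\<Sum>v\<in>Poly_Mapping.keys m. Poly_Mapping.lookup m v)"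

definition homog_comp :: "'v set \<Rightarrow> int \<Rightarrow> ('v, 'a::comm_ring_1) mpol set" where
  "homog_comp V d = {p \<in> carrier (mpol_ring V).
     \<forall>m\<in>Poly_Mapping.keys p. int (monom_degree m) = d}"

definition homog_max_ideal :: "'v set \<Rightarrow> ('v, 'a::comm_ring_1) mpol set" where
  "homog_max_ideal V = Idl\<^bsub>mpol_ring V\<^esub> (mvar ` V)"

section \<open>Free modules, quotients and cokernels\<close>

text \<open>Since \<^typ>\<open>('a, 'b) module\<close> extends the record of rings, its multiplicative fields are
  present but irrelevant.\<close>

definition free_mod :: "'a ring \<Rightarrow> nat \<Rightarrow> ('a, 'a vec) module" where
  "free_mod A m = \<lparr>carrier = {v \<in> carrier_vec m. \<forall>i<m. v $ i \<in> carrier A},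
     monoid.mult = undefined, one = undefined,
     zero = vec m (\<lambda>_. \<zero>\<^bsub>A\<^esub>),
     add = (\<lambda>v w. vec m (\<lambda>i. v $ i \<oplus>\<^bsub>A\<^esub> w $ i)),
     module.smult = (\<lambda>a v. vec m (\<lambda>i. a \<otimes>\<^bsub>A\<^esub> v $ i))\<rparr>"

definition mat_map :: "'a ring \<Rightarrow> 'a mat \<Rightarrow> 'a vec \<Rightarrow> 'a vec" where
  "mat_map A D v = vec (dim_row D) (\<lambda>i. \<Oplus>\<^bsub>A\<^esub>j\<in>{..<dim_col D}. D $$ (i, j) \<otimes>\<^bsub>A\<^esub> v $ j)"

definition mat_image :: "'a ring \<Rightarrow> 'a mat \<Rightarrow> 'a vec set" where
  "mat_image A D = mat_map A D ` carrier (free_mod A (dim_col D))"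

text \<open>The quotient of a module by a submodule, in the style of \<^const>\<open>FactRing\<close>.\<close>

definition quot_mod :: "('a, 'b) module \<Rightarrow> 'b set \<Rightarrow> ('a, 'b set) module" where
  "quot_mod M N = \<lparr>carrier = a_rcosets\<^bsub>M\<^esub> N,
     monoid.mult = undefined, one = undefined,
     zero = N, add = set_add M,
     module.smult = (\<lambda>a C. \<Union>x\<in>C. N +>\<^bsub>M\<^esub> (a \<odot>\<^bsub>M\<^esub> x))\<rparr>"

definition coker :: "'a ring \<Rightarrow> 'a mat \<Rightarrow> ('a, 'a vec set) module" where
  "coker A D = quot_mod (free_mod A (dim_row D)) (mat_image A D)"

definition coker_proj :: "'a ring \<Rightarrow> 'a mat \<Rightarrow> 'a vec \<Rightarrow> 'a vec set" where
  "coker_proj A D v = mat_image A D +>\<^bsub>free_mod A (dim_row D)\<^esub> v"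

definition restrict_scalars :: "('q \<Rightarrow> 'a) \<Rightarrow> ('a, 'm) module \<Rightarrow> ('q, 'm) module" where
  "restrict_scalars \<phi> M = \<lparr>carrier = carrier M,
     monoid.mult = monoid.mult M, one = \<one>\<^bsub>M\<^esub>,
     zero = \<zero>\<^bsub>M\<^esub>, add = (\<lambda>x y. x \<oplus>\<^bsub>M\<^esub> y),
     module.smult = (\<lambda>q x. \<phi> q \<odot>\<^bsub>M\<^esub> x)\<rparr>"

section \<open>Graded modules and graded free resolutions over a polynomial ring\<close>

text \<open>\<open>M\<close> is the direct sum of the subgroups \<open>gr d\<close>, compatibly with the standard grading of the
  polynomial ring.\<close>

definition graded_module ::
  "'v set \<Rightarrow> (('v, 'a::comm_ring_1) mpol, 'm) module \<Rightarrow> (int \<Rightarrow> 'm set) \<Rightarrow> bool" where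
  "graded_module V M gr \<longleftrightarrow>
     Module.module (mpol_ring V) M \<and>
     (\<forall>d. subgroup (gr d) (add_monoid M)) \<and>
     (\<forall>c d. \<forall>p\<in>homog_comp V c. \<forall>x\<in>gr d. p \<odot>\<^bsub>M\<^esub> x \<in> gr (c + d)) \<and>
     (\<forall>x\<in>carrier M. \<exists>!f. (\<forall>d. f d \<in> gr d) \<and> finite {d. f d \<noteq> \<zero>\<^bsub>M\<^esub>} \<and>
        x = (\<Oplus>\<^bsub>M\<^esub>d\<in>{d. f d \<noteq> \<zero>\<^bsub>M\<^esub>}. f d))"

text \<open>A list \<open>s\<close> of integers stands for the graded free module with a basis whose \<open>j\<close>-th element
  has degree \<open>s ! j\<close>, i.e. for the direct sum of the twists \<open>Q(- s ! j)\<close>.\<close>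

definition graded_free_comp :: "'v set \<Rightarrow> int list \<Rightarrow> int \<Rightarrow> ('v, 'a::comm_ring_1) mpol vec set" where
  "graded_free_comp V s d = {v \<in> carrier (free_mod (mpol_ring V) (length s)).
     \<forall>j<length s. v $ j \<in> homog_comp V (d - s ! j)}"

text \<open>The sequence \<open>0 \<rightarrow> F\<^sub>p \<rightarrow> \<dots> \<rightarrow> F\<^sub>1 \<rightarrow> F\<^sub>0 \<rightarrow> M \<rightarrow> 0\<close>, where \<open>F\<^sub>i\<close> is the graded free module given by
  \<open>ss ! i\<close>, the map \<open>F\<^sub>i\<^sub>+\<^sub>1 \<rightarrow> F\<^sub>i\<close> is given by the matrix \<open>ds ! i\<close>, and \<open>F\<^sub>0 \<rightarrow> M\<close> is \<open>\<epsilon>\<close>, is exact and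
  all its maps are homogeneous of degree 0.\<close>

definition graded_free_resolution ::
  "'v set \<Rightarrow> (('v, 'a::comm_ring_1) mpol, 'm) module \<Rightarrow> (int \<Rightarrow> 'm set) \<Rightarrow>
   int list list \<Rightarrow> ('v, 'a) mpol mat list \<Rightarrow> (('v, 'a) mpol vec \<Rightarrow> 'm) \<Rightarrow> bool" where
  "graded_free_resolution V M gr ss ds \<epsilon> \<longleftrightarrow>
    (let F = (\<lambda>i. free_mod (mpol_ring V) (length (ss ! i)));
         im = (\<lambda>i. if i < length ds then (\<lambda>v. ds ! i *\<^sub>v v) ` carrier (F (Suc i))
                   else {0\<^sub>v (length (ss ! i))})
     in graded_module V M gr \<and>
        length ss = Suc (length ds) \<and>
        (\<forall>i<length ds. ds ! i \<in> carrier_mat (length (ss ! i)) (length (ss ! Suc i)) \<and>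
           (\<forall>a<length (ss ! i). \<forall>b<length (ss ! Suc i).
              ds ! i $$ (a, b) \<in> homog_comp V (ss ! Suc i ! b - ss ! i ! a))) \<and>
        \<epsilon> \<in> LinearCombinations.module_hom (mpol_ring V) (F 0) M \<and>
        (\<forall>d. \<epsilon> ` graded_free_comp V (ss ! 0) d \<subseteq> gr d) \<and>
        \<epsilon> ` carrier (F 0) = carrier M \<and>
        {v \<in> carrier (F 0). \<epsilon> v = \<zero>\<^bsub>M\<^esub>} = im 0 \<and>
        (\<forall>i<length ds. {v \<in> carrier (F (Suc i)). ds ! i *\<^sub>v v = 0\<^sub>v (length (ss ! i))} = im (Suc i)))"

definition minimal_graded_free_resolution ::
  "'v set \<Rightarrow> (('v, 'a::comm_ring_1) mpol, 'm) module \<Rightarrow> (int \<Rightarrow> 'm set) \<Rightarrow>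
   int list list \<Rightarrow> ('v, 'a) mpol mat list \<Rightarrow> (('v, 'a) mpol vec \<Rightarrow> 'm) \<Rightarrow> bool" where
  "minimal_graded_free_resolution V M gr ss ds \<epsilon> \<longleftrightarrow>
     graded_free_resolution V M gr ss ds \<epsilon> \<and>
     (\<forall>D\<in>set ds. \<forall>a<dim_row D. \<forall>b<dim_col D. D $$ (a, b) \<in> homog_max_ideal V)"

section \<open>Maximal minors of the generic \<open>n \<times> (n+1)\<close> matrix\<close>

text \<open>All indices are shifted to start at 0; the variable \<open>(i, j)\<close> is the entry in row \<open>i\<close> and
  column \<open>j\<close> of the generic matrix.\<close>

type_synonym 'a gpol = "(nat \<times> nat, 'a) mpol"

definition gvars :: "nat \<Rightarrow> (nat \<times> nat) set" where
  "gvars n = {..<n} \<times> {..<n + 1}"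

definition Q_ring :: "nat \<Rightarrow> 'a::field gpol ring" where
  "Q_ring n = mpol_ring (gvars n)"

definition generic_mat :: "nat \<Rightarrow> 'a::field gpol mat" where
  "generic_mat n = mat n (n + 1) (\<lambda>(i, j). mvar (i, j))"

text \<open>As \<open>j\<close> runs through \<open>{..<n}\<close>, \<^term>\<open>insert_index r j\<close> runs in order through
  \<open>{..<n + 1} - {r}\<close>.\<close>

definition minor :: "nat \<Rightarrow> nat \<Rightarrow> 'a::field gpol" where
  "minor n r = det (mat n n (\<lambda>(i, j). generic_mat n $$ (i, insert_index r j)))"

definition I_ideal :: "nat \<Rightarrow> 'a::field gpol set" where
  "I_ideal n = Idl\<^bsub>Q_ring n\<^esub> (minor n ` {..<n + 1})"

definition R_ring :: "nat \<Rightarrow> 'a::field gpol set ring" where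
  "R_ring n = Q_ring n Quot I_ideal n"

definition R_proj :: "nat \<Rightarrow> 'a::field gpol \<Rightarrow> 'a gpol set" where
  "R_proj n q = I_ideal n +>\<^bsub>Q_ring n\<^esub> q"

text \<open>Column \<open>c\<close> belongs to the \<open>c\<close>-th variable in the row-by-row order.\<close>

definition J_Q :: "nat \<Rightarrow> 'a::field gpol mat" where
  "J_Q n = mat (n + 1) (n * (n + 1))
     (\<lambda>(i, c). partial_deriv (c div (n + 1), c mod (n + 1)) (minor n i))"

definition J_R :: "nat \<Rightarrow> 'a::field gpol set mat" where
  "J_R n = map_mat (R_proj n) (J_Q n)"

definition A_block :: "nat \<Rightarrow> nat \<Rightarrow> 'a::field gpol mat" where
  "A_block n k = mat (n + 1) (n - 1) (\<lambda>(i, j). transpose_mat (generic_mat n) $$ (i, insert_index k j))"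

definition B_col :: "nat \<Rightarrow> nat \<Rightarrow> 'a::field gpol vec" where
  "B_col n l = finsum_vec TYPE('a gpol) (n * (n + 1))
     (\<lambda>s. (- generic_mat n $$ (0, s)) \<cdot>\<^sub>v unit_vec (n * (n + 1)) s
          + generic_mat n $$ (l, s) \<cdot>\<^sub>v unit_vec (n * (n + 1)) (l * (n + 1) + s)) {..<n + 1}"

text \<open>The two lower blocks have no rows: the two upper blocks are just put side by side.\<close>

definition del2 :: "nat \<Rightarrow> 'a::field gpol mat" where
  "del2 n = four_block_mat
     (diag_block_mat (map (A_block n) [0..<n])) (mat_of_cols (n * (n + 1)) (map (B_col n) [1..<n]))
     (0\<^sub>m 0 (n * (n - 1))) (0\<^sub>m 0 (n - 1))"

text \<open>The cokernel of \<^const>\<open>J_R\<close> is an \<open>R\<close>-module, considered as a \<open>Q\<close>-module via \<open>Q \<rightarrow> R\<close>. It is graded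
  as a quotient of \<open>R\<^sup>n\<^sup>+\<^sup>1\<close> with the standard basis in degree 0, \<open>R\<close> having the grading induced by \<open>Q\<close>.\<close>

definition coker_J_R :: "nat \<Rightarrow> ('a::field gpol, 'a gpol set vec set) module" where
  "coker_J_R n = restrict_scalars (R_proj n) (coker (R_ring n) (J_R n))"

definition coker_J_R_grading :: "nat \<Rightarrow> int \<Rightarrow> 'a::field gpol set vec set set" where
  "coker_J_R_grading n d = coker_proj (R_ring n) (J_R n) `
     {v \<in> carrier (free_mod (R_ring n) (n + 1)).
        \<forall>i<n + 1. v $ i \<in> R_proj n ` homog_comp (gvars n) d}"

definition augmentation :: "nat \<Rightarrow> 'a::field gpol vec \<Rightarrow> 'a gpol set vec set" where
  "augmentation n v = coker_proj (R_ring n) (J_R n) (map_vec (R_proj n) v)"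

end

theory Submission
  imports Defs "HOL-Library.Product_Lexorder"
begin

text \<open>
  Let \<open>X\<close> be the generic \<open>n \<times> (n + 1)\<close> matrix and \<open>F\<^sub>r\<close> its maximal minor without column \<open>r\<close>. A vector
  of \<open>Q\<^sup>n\<^sup>(\<^sup>n\<^sup>+\<^sup>1\<^sup>)\<close> is best read as an \<open>n \<times> (n + 1)\<close> matrix \<open>Y\<close>: then \<open>J\<^sub>Q Y\<close> is the derivative of
  \<open>(F\<^sub>0, \<dots>, F\<^sub>n)\<close> at \<open>X\<close> in the direction \<open>Y\<close>, that is, the sum over the rows \<open>k\<close> of the minors of \<open>X\<close>
  with row \<open>k\<close> replaced by row \<open>k\<close> of \<open>Y\<close>. Likewise the \<open>(n - 1)(n + 1) = n\<^sup>2 - 1\<close> coordinates of the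
  last module are those of a trace-free \<open>n \<times> n\<close> matrix \<open>M\<close>: the columns of \<open>A\<^sub>k\<close> belong to the entries
  of row \<open>k\<close> off the diagonal, \<open>B\<^sub>l\<close> to the diagonal matrix with entries \<open>-1\<close> and \<open>1\<close> in the places
  \<open>0\<close> and \<open>l\<close>, and the last map of the resolution is \<open>M \<mapsto> M X\<close>. It is injective because the rows of
  \<open>X\<close> are linearly independent, and \<open>J\<^sub>Q (M X) = tr M \<cdot> (F\<^sub>0, \<dots>, F\<^sub>n)\<close> shows that the maps compose to zero.

  Everything else comes from Cramer's rule for the square matrices obtained by putting a row \<open>w\<close> on
  top of a matrix with \<open>n\<close> rows (\<open>cramer_stack\<close>).

  \<^item> Exactness in the middle. If \<open>J\<^sub>Q Y = 0\<close>, pairing with row \<open>l\<close> of \<open>X\<close> shows that row \<open>l\<close> of \<open>Y\<close> on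
    top of \<open>X\<close> has determinant \<open>0\<close>. By Cramer's rule, \<open>F\<^sub>r\<close> times this row is a combination of the rows
    of \<open>X\<close>, for every \<open>r\<close>. Using this for \<open>r = 0\<close> and \<open>r = n\<close>, and the fact that \<open>F\<^sub>0\<close> and \<open>F\<^sub>n\<close> are
    coprime, the row itself is such a combination. Hence \<open>Y = M X\<close>, and then \<open>tr M \<cdot> F\<^sub>n = 0\<close> forces
    \<open>tr M = 0\<close>.

  \<^item> Coprimality is obtained without unique factorization. For the weight that counts the variables
    \<open>x\<^sub>i\<^sub>,\<^sub>i\<close> and \<open>x\<^sub>i\<^sub>,\<^sub>i\<^sub>+\<^sub>1\<close> of a monomial, the top parts of \<open>F\<^sub>n\<close> and \<open>F\<^sub>0\<close> are the single monomials
    \<open>\<Prod> x\<^sub>i\<^sub>,\<^sub>i\<close> and \<open>\<Prod> x\<^sub>i\<^sub>,\<^sub>i\<^sub>+\<^sub>1\<close>, which have no variable in common, and division by the top parts applies.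

  \<^item> The cokernels of \<open>J\<^sub>Q\<close> and \<open>J\<^sub>R\<close> agree, because \<open>F\<^sub>i e\<^sub>j\<close> lies in the image of \<open>J\<^sub>Q\<close> for all \<open>i\<close>
    and \<open>j\<close>. This is once more Cramer's rule, with a standard basis row on top.

  The grading of the cokernel is inherited from \<open>Q\<^sup>n\<^sup>+\<^sup>1\<close>, since the entries of \<open>J\<^sub>Q\<close> are homogeneous of the
  common degree \<open>n - 1\<close>, so that the image of \<open>J\<^sub>Q\<close> contains the homogeneous components of its elements.
  Minimality holds as all the entries have positive degree.

  The lexicographic order on pairs of indices serves to make the polynomials an instance of the class
  of integral domains, which asks for ordered variables.
\<close>

section \<open>Parts of a polynomial\<close>

abbreviation keys where "keys \<equiv> Poly_Mapping.keys"
abbreviation lookup where "lookup \<equiv> Poly_Mapping.lookup"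
abbreviation single where "single \<equiv> Poly_Mapping.single"

text \<open>The terms of \<open>p\<close> whose monomials lie in \<open>S\<close>. Three choices of \<open>S\<close> are used: the monomials of a given
  weight, those of a given degree, and those in a given set of variables.\<close>

lift_definition mon_part :: "'m set \<Rightarrow> ('m \<Rightarrow>\<^sub>0 'a::zero) \<Rightarrow> ('m \<Rightarrow>\<^sub>0 'a)"
  is "\<lambda>S p m. if m \<in> S then p m else 0"
  by (auto elim: rev_finite_subset)

lemma lookup_mon_part: "lookup (mon_part S p) m = (if m \<in> S then lookup p m else 0)"
  by transfer simp

lemma keys_mon_part: "keys (mon_part S p) = keys p \<inter> S"
  by (auto simp: in_keys_iff lookup_mon_part split: if_splits)

lemma mon_part_add: "mon_part S (p + q) = mon_part S p + mon_part S q"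
  by (rule poly_mapping_eqI) (simp add: lookup_mon_part lookup_add)

lemma mon_part_diff: "mon_part S (p - q) = mon_part S p - mon_part S q"
  by (rule poly_mapping_eqI) (simp add: lookup_mon_part lookup_minus)

lemma mon_part_zero: "mon_part S 0 = 0"
  by (rule poly_mapping_eqI) (simp add: lookup_mon_part)

lemma mon_part_sum: "mon_part S (sum f A) = (\<Sum>x\<in>A. mon_part S (f x))"
  by (rule poly_mapping_eqI) (simp add: lookup_mon_part lookup_sum)

lemma mon_part_split: "p = mon_part S p + mon_part (- S) p"
  by (rule poly_mapping_eqI) (simp add: lookup_mon_part lookup_add)

lemma mon_part_id: "keys p \<subseteq> S \<Longrightarrow> mon_part S p = p"
  by (rule poly_mapping_eqI) (auto simp: lookup_mon_part in_keys_iff)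

lemma mon_part_eq_zero: "keys p \<inter> S = {} \<Longrightarrow> mon_part S p = 0"
  by (rule poly_mapping_eqI) (auto simp: lookup_mon_part in_keys_iff)

text \<open>Multiplication by \<open>a\<close> sends monomials in \<open>T\<close> to monomials in \<open>S\<close> and the others outside of \<open>S\<close>, so
  it commutes with taking parts. For weights and degrees this says that a homogeneous factor shifts the
  components; for variables it makes the truncation to a polynomial subring linear over that subring.\<close>

lemma mon_part_mult:
  fixes a p :: "('v, 'a::comm_ring_1) mpol"
  assumes "\<And>m m'. m \<in> keys a \<Longrightarrow> m + m' \<in> S \<longleftrightarrow> m' \<in> T"
  shows "mon_part S (a * p) = a * mon_part T p"
proof -
  have "a * p = a * mon_part T p + a * mon_part (- T) p"
    by (subst mon_part_split[of p T]) (simp add: distrib_left)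
  moreover have "keys (a * mon_part T p) \<subseteq> S"
    using keys_mult[of a "mon_part T p"] assms by (fastforce simp: keys_mon_part)
  moreover have "keys (a * mon_part (- T) p) \<inter> S = {}"
    using keys_mult[of a "mon_part (- T) p"] assms by (fastforce simp: keys_mon_part)
  ultimately show ?thesis
    by (simp add: mon_part_add mon_part_id mon_part_eq_zero)
qed

section \<open>Monomial factors and coprime polynomials\<close>

lemma sum_single: "p = (\<Sum>m\<in>keys p. single m (lookup p m))"
  by (rule poly_mapping_eqI) (auto simp: lookup_sum lookup_single when_def in_keys_iff)

lemma lookup_single_mult:
  fixes p :: "('v, 'a::comm_ring_1) mpol"
  shows "lookup (single s 1 * p) (s + m) = lookup p m"
proof -
  have "single s 1 * p = (\<Sum>m'\<in>keys p. single (s + m') (lookup p m'))"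
    by (subst sum_single[of p]) (simp add: sum_distrib_left mult_single)
  then show ?thesis
    by (auto simp: lookup_sum lookup_single when_def in_keys_iff)
qed

lemma keys_single_mult:
  fixes p :: "('v, 'a::comm_ring_1) mpol"
  shows "keys (single s 1 * p) = (+) s ` keys p"
proof
  show "keys (single s 1 * p) \<subseteq> (+) s ` keys p"
    using keys_mult[of "single s 1" p] by (auto split: if_splits)
  show "(+) s ` keys p \<subseteq> keys (single s 1 * p)"
    by (auto simp: in_keys_iff lookup_single_mult)
qed

lemma monomial_dvd:
  fixes p :: "('v, 'a::comm_ring_1) mpol"
  assumes "\<And>m. m \<in> keys p \<Longrightarrow> \<exists>m'. m = s + m'"
  obtains q where "p = single s 1 * q"
proof
  show "p = single s 1 * (\<Sum>m\<in>keys p. single (m - s) (lookup p m))"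
    by (subst sum_single[of p], unfold sum_distrib_left mult_single, rule sum.cong)
      (use assms in force)+
qed

text \<open>A form of coprimality that needs no factorization theory: when the parts of top weight of \<open>F\<close> and \<open>G\<close>
  are monomials without a common variable, \<open>F a = G b\<close> forces \<open>G\<close> to divide \<open>a\<close>. The parts of top weight
  of \<open>a\<close> and \<open>b\<close> satisfy the same relation with the two monomials in place of \<open>F\<close> and \<open>G\<close>, hence are
  \<open>x\<^sup>t c\<close> and \<open>x\<^sup>s c\<close> for some \<open>c\<close>. Replacing \<open>a\<close> and \<open>b\<close> by \<open>a - G c\<close> and \<open>b - F c\<close> lowers the weight.\<close>

lemma coprime_leading_monomials:
  fixes F G a b :: "('v::linorder, 'a::idom) mpol" and wt :: "('v \<Rightarrow>\<^sub>0 nat) \<Rightarrow> nat"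
  assumes wt_add: "\<And>m m'. wt (m + m') = wt m + wt m'"
    and F: "F = single s 1 + F'" "\<And>m. m \<in> keys F' \<Longrightarrow> wt m < d" and s: "wt s = d"
    and G: "G = single t 1 + G'" "\<And>m. m \<in> keys G' \<Longrightarrow> wt m < d" and t: "wt t = d"
    and disj: "keys s \<inter> keys t = {}"
    and eq: "F * a = G * b"
  shows "\<exists>c. a = G * c"
proof -
  have "\<exists>c. a = G * c"
    if "F * a = G * b" "\<And>m. m \<in> keys a \<union> keys b \<Longrightarrow> wt m < N" for N a b
    using that
  proof (induction N arbitrary: a b)
    case 0
    then have "a = 0" by (metis UnI1 not_less_zero keys_eq_empty all_not_in_conv)
    then show ?case by (intro exI[of _ 0]) simp
  next
    case (Suc N)
    have top: "mon_part {m. wt m = d + N} (P * p) = single u 1 * mon_part {m. wt m = N} p"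
      if P: "P = single u 1 + P'" "\<And>m. m \<in> keys P' \<Longrightarrow> wt m < d" and u: "wt u = d"
        and p: "\<And>m. m \<in> keys p \<Longrightarrow> wt m < Suc N"
      for P p P' :: "('v, 'a) mpol" and u
    proof -
      have "mon_part {m. wt m = d + N} (single u 1 * p) = single u 1 * mon_part {m. wt m = N} p"
        by (rule mon_part_mult) (use u wt_add in \<open>auto split: if_splits\<close>)
      moreover have "mon_part {m. wt m = d + N} (P' * p) = 0"
        by (rule mon_part_eq_zero) (use keys_mult[of P' p] P(2) p wt_add in fastforce)
      ultimately show ?thesis by (simp add: P distrib_right mon_part_add)
    qed
    define aN where "aN = mon_part {m. wt m = N} a"
    define bN where "bN = mon_part {m. wt m = N} b"
    have ab: "single s 1 * aN = single t 1 * bN"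
      using top[OF F(1) F(2) s, of a] top[OF G(1) G(2) t, of b] Suc.prems
      unfolding aN_def bN_def by simp
    have "\<exists>m'. m = t + m'" if m: "m \<in> keys aN" for m
    proof -
      have "s + m \<in> (+) t ` keys bN"
        using m ab by (metis imageI keys_single_mult)
      then obtain m' where m': "s + m = t + m'" by auto
      have "m = t + (m - t)"
      proof (rule poly_mapping_eqI)
        fix v
        have "lookup s v + lookup m v = lookup t v + lookup m' v"
          using m' by (metis lookup_add)
        moreover have "lookup s v = 0 \<or> lookup t v = 0"
          using disj by (auto simp: in_keys_iff)
        ultimately show "lookup m v = lookup (t + (m - t)) v"
          by (auto simp: lookup_add lookup_minus)
      qed
      then show ?thesis by blast
    qed
    then obtain c where c: "aN = single t 1 * c" by (rule monomial_dvd)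
    have "single t 1 * (single s 1 * c) = single t 1 * bN"
      using ab c by (metis mult.left_commute)
    then have c': "bN = single s 1 * c"
      by (metis mult_cancel_left one_neq_zero lookup_single_eq lookup_zero)
    have wt_c: "d + wt m = N" if "m \<in> keys c" for m
    proof -
      have "t + m \<in> keys aN" using that by (simp add: c keys_single_mult)
      then have "wt (t + m) = N" by (simp add: aN_def keys_mon_part)
      then show ?thesis by (simp add: wt_add t)
    qed
    \<comment> \<open>The same estimate serves \<open>a - G c\<close> and \<open>b - F c\<close>: in both cases the part of weight \<open>N\<close> cancels.\<close>
    have low: "wt m < N"
      if p: "\<And>m. m \<in> keys p \<Longrightarrow> wt m < Suc N" and pc: "mon_part {m. wt m = N} p = single u 1 * c"
        and P: "P = single u 1 + P'" "\<And>m. m \<in> keys P' \<Longrightarrow> wt m < d"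
        and m: "m \<in> keys (p - P * c)" for p P P' :: "('v, 'a) mpol" and u m
    proof -
      have "p - P * c = mon_part (- {m. wt m = N}) p - P' * c"
        using mon_part_split[of p "{m. wt m = N}"] pc P by (simp add: algebra_simps)
      then have "m \<in> keys (mon_part (- {m. wt m = N}) p) \<union> keys (P' * c)"
        using m keys_diff by fastforce
      then show ?thesis
        using p keys_mult[of P' c] P(2) wt_c wt_add
        by (fastforce simp: keys_mon_part less_Suc_eq)
    qed
    have "\<exists>c'. a - G * c = G * c'"
    proof (rule Suc.IH)
      show "F * (a - G * c) = G * (b - F * c)"
        using Suc.prems(1) by (simp add: algebra_simps)
      show "wt m < N" if "m \<in> keys (a - G * c) \<union> keys (b - F * c)" for m
        using that low[of a t G G' m] low[of b s F F' m] Suc.prems(2) c c' F G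
        unfolding aN_def bN_def by auto
    qed
    then obtain c' where "a - G * c = G * c'" by blast
    then have "a = G * (c + c')" by (simp add: algebra_simps)
    then show ?case by blast
  qed
  moreover obtain N where "\<And>m. m \<in> keys a \<union> keys b \<Longrightarrow> wt m < N"
    using finite_nat_set_iff_bounded[of "wt ` (keys a \<union> keys b)"] by auto
  ultimately show ?thesis using eq by blast
qed

section \<open>Maximal minors and their derivative\<close>

text \<open>Bordering an \<open>n\<close>-rowed matrix by a row turns statements on its maximal minors into statements on
  square determinants: by expansion along the new row, \<open>det (stack n w Z)\<close> is the pairing of \<open>w\<close> with
  the vector of signed maximal minors of \<open>Z\<close>.\<close>

definition stack :: "nat \<Rightarrow> (nat \<Rightarrow> 'a) \<Rightarrow> (nat \<Rightarrow> nat \<Rightarrow> 'a) \<Rightarrow> 'a mat" where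
  "stack n w Z = mat (n + 1) (n + 1) (\<lambda>(i, j). if i = 0 then w j else Z (i - 1) j)"

definition max_minor :: "nat \<Rightarrow> (nat \<Rightarrow> nat \<Rightarrow> 'a::comm_ring_1) \<Rightarrow> nat \<Rightarrow> 'a" where
  "max_minor n Z r = det (mat n n (\<lambda>(i, j). Z i (insert_index r j)))"

definition unit_fun :: "nat \<Rightarrow> nat \<Rightarrow> 'a::zero_neq_one" where
  "unit_fun r j = (if j = r then 1 else 0)"

text \<open>Since minors are linear in every row, this is the derivative of the minor at \<open>X\<close> in the direction \<open>Y\<close>.\<close>

definition dmax_minor ::
  "nat \<Rightarrow> (nat \<Rightarrow> nat \<Rightarrow> 'a::comm_ring_1) \<Rightarrow> (nat \<Rightarrow> nat \<Rightarrow> 'a) \<Rightarrow> nat \<Rightarrow> 'a" where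
  "dmax_minor n X Y r = (\<Sum>k<n. max_minor n (X(k := Y k)) r)"

lemma stack_carrier [simp]: "stack n w Z \<in> carrier_mat (Suc n) (Suc n)"
  by (simp add: stack_def)

lemma det_stack_row_0:
  fixes Z :: "nat \<Rightarrow> nat \<Rightarrow> 'a::comm_ring_1"
  shows "det (stack n w Z) = (\<Sum>r<n + 1. w r * ((-1) ^ r * max_minor n Z r))"
proof -
  have "mat_delete (stack n w Z) 0 r = mat n n (\<lambda>(i, j). Z i (insert_index r j))" if "r < n + 1" for r
    by (rule eq_matI) (use that in \<open>auto simp: mat_delete_def stack_def insert_index_def\<close>)
  moreover have "det (stack n w Z) = (\<Sum>r<n + 1. stack n w Z $$ (0, r) * cofactor (stack n w Z) 0 r)"
    by (rule laplace_expansion_row) simp_all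
  ultimately show ?thesis
    by (simp add: cofactor_def max_minor_def stack_def)
qed

lemma det_stack_unit:
  fixes Z :: "nat \<Rightarrow> nat \<Rightarrow> 'a::comm_ring_1"
  assumes "r < n + 1"
  shows "det (stack n (unit_fun r) Z) = (-1) ^ r * max_minor n Z r"
proof -
  have "(\<Sum>j<n + 1. unit_fun r j * ((-1) ^ j * max_minor n Z j)) =
      (\<Sum>j<n + 1. if j = r then (-1) ^ r * max_minor n Z r else 0)"
    by (rule sum.cong) (auto simp: unit_fun_def)
  then show ?thesis using assms by (simp add: det_stack_row_0)
qed

lemma det_stack_row_Suc:
  fixes Z :: "nat \<Rightarrow> nat \<Rightarrow> 'a::comm_ring_1"
  assumes "k < n"
  shows "det (stack n w (Z(k := v))) = (\<Sum>i<n + 1. v i * cofactor (stack n w Z) (k + 1) i)"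
proof -
  have "mat_delete (stack n w (Z(k := v))) (k + 1) i = mat_delete (stack n w Z) (k + 1) i" for i
    by (rule eq_matI) (use assms in \<open>auto simp: mat_delete_def stack_def\<close>)
  moreover have "det (stack n w (Z(k := v))) =
      (\<Sum>i<n + 1. stack n w (Z(k := v)) $$ (k + 1, i) * cofactor (stack n w (Z(k := v))) (k + 1) i)"
    by (rule laplace_expansion_row) (use assms in simp_all)
  ultimately show ?thesis
    using assms by (simp add: cofactor_def stack_def)
qed

lemma det_stack_row_0_cofactor:
  fixes Z :: "nat \<Rightarrow> nat \<Rightarrow> 'a::comm_ring_1"
  shows "det (stack n v Z) = (\<Sum>i<n + 1. v i * cofactor (stack n w Z) 0 i)"
proof -
  have "mat_delete (stack n v Z) 0 i = mat_delete (stack n w Z) 0 i" for i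
    by (rule eq_matI) (auto simp: mat_delete_def stack_def)
  moreover have "det (stack n v Z) = (\<Sum>i<n + 1. stack n v Z $$ (0, i) * cofactor (stack n v Z) 0 i)"
    by (rule laplace_expansion_row) simp_all
  ultimately show ?thesis
    by (simp add: cofactor_def stack_def)
qed

lemma det_stack_repeated:
  fixes Z :: "nat \<Rightarrow> nat \<Rightarrow> 'a::comm_ring_1"
  assumes "l < n"
  shows "det (stack n (Z l) Z) = 0"
  by (rule det_identical_rows[where i = 0 and j = "l + 1" and n = "n + 1"])
    (use assms in \<open>auto simp: stack_def intro!: eq_vecI\<close>)

lemma det_stack_repeated':
  fixes Z :: "nat \<Rightarrow> nat \<Rightarrow> 'a::comm_ring_1"
  assumes "k < n" "l < n" "l \<noteq> k"
  shows "det (stack n w (Z(k := Z l))) = 0"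
  by (rule det_identical_rows[where i = "k + 1" and j = "l + 1" and n = "n + 1"])
    (use assms in \<open>auto simp: stack_def intro!: eq_vecI\<close>)

lemma det_stack_swap:
  fixes Z :: "nat \<Rightarrow> nat \<Rightarrow> 'a::comm_ring_1"
  assumes "l < n"
  shows "det (stack n (Z l) (Z(l := y))) = - det (stack n y Z)"
proof -
  have "stack n (Z l) (Z(l := y)) = swaprows 0 (l + 1) (stack n y Z)"
    by (rule eq_matI) (use assms in \<open>auto simp: stack_def\<close>)
  then show ?thesis
    using det_swaprows[of 0 "n + 1" "l + 1" "stack n y Z"] assms by simp
qed

text \<open>Cramer's rule for the square matrix with rows \<open>w\<close> and those of \<open>Z\<close>, multiplied by its determinant: the
  row \<open>y\<close> is a combination of these rows, and the coefficient of a row is the determinant of the matrix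
  in which \<open>y\<close> takes its place.\<close>

lemma cramer_stack:
  fixes Z :: "nat \<Rightarrow> nat \<Rightarrow> 'a::comm_ring_1"
  assumes j: "j < n + 1"
  shows "y j * det (stack n w Z) =
    det (stack n y Z) * w j + (\<Sum>k<n. det (stack n w (Z(k := y))) * Z k j)"
proof -
  let ?A = "stack n w Z"
  have adj: "(\<Sum>a<n + 1. cofactor ?A a i * ?A $$ (a, j)) = (if i = j then det ?A else 0)"
    if "i < n + 1" for i
  proof -
    have "(adj_mat ?A * ?A) $$ (i, j) = (\<Sum>a<n + 1. cofactor ?A a i * ?A $$ (a, j))"
      using that j by (simp add: adj_mat_def scalar_prod_def stack_def atLeast0LessThan)
    moreover have "(adj_mat ?A * ?A) $$ (i, j) = (if i = j then det ?A else 0)"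
      using adj_mat(3)[OF stack_carrier, of n w Z] that j by simp
    ultimately show ?thesis by simp
  qed
  have "y j * det ?A = (\<Sum>i<n + 1. y i * (if i = j then det ?A else 0))"
    using j by (subst sum.cong[OF refl, where h = "\<lambda>i. if i = j then y j * det ?A else 0"]) auto
  also have "\<dots> = (\<Sum>i<n + 1. \<Sum>a<n + 1. y i * cofactor ?A a i * ?A $$ (a, j))"
    by (intro sum.cong refl) (simp add: adj[symmetric] sum_distrib_left mult.assoc del: sum.lessThan_Suc)
  also have "\<dots> = (\<Sum>a<n + 1. (\<Sum>i<n + 1. y i * cofactor ?A a i) * ?A $$ (a, j))"
    by (subst sum.swap) (simp add: sum_distrib_right del: sum.lessThan_Suc)
  also have "\<dots> = (\<Sum>i<n + 1. y i * cofactor ?A 0 i) * ?A $$ (0, j) +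
      (\<Sum>k<n. (\<Sum>i<n + 1. y i * cofactor ?A (k + 1) i) * ?A $$ (k + 1, j))"
    unfolding Suc_eq_plus1[symmetric] sum.lessThan_Suc_shift[of _ n] by simp
  also have "\<dots> = det (stack n y Z) * w j + (\<Sum>k<n. det (stack n w (Z(k := y))) * Z k j)"
  proof -
    have "?A $$ (0, j) = w j" "\<And>k. k < n \<Longrightarrow> ?A $$ (k + 1, j) = Z k j"
      using j by (simp_all add: stack_def)
    then show ?thesis
      by (simp add: det_stack_row_Suc det_stack_row_0_cofactor[of n y Z w] del: sum.lessThan_Suc)
  qed
  finally show ?thesis .
qed

lemma max_minor_eq:
  fixes Z :: "nat \<Rightarrow> nat \<Rightarrow> 'a::comm_ring_1"
  assumes "r < n + 1"
  shows "max_minor n Z r = (-1) ^ r * det (stack n (unit_fun r) Z)"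
  using assms by (simp add: det_stack_unit flip: mult.assoc power_add mult_2)

text \<open>By linearity in row \<open>k\<close>, the \<open>k\<close>-th summand of the derivative is the sum of the \<open>M k l\<close> times the
  minor of \<open>X\<close> with row \<open>k\<close> replaced by row \<open>l\<close>, and such a minor vanishes unless \<open>l = k\<close>.\<close>

lemma dmax_minor_row_combination:
  fixes X :: "nat \<Rightarrow> nat \<Rightarrow> 'a::comm_ring_1"
  assumes r: "r < n + 1"
  shows "dmax_minor n X (\<lambda>k j. \<Sum>l<n. M k l * X l j) r = (\<Sum>k<n. M k k) * max_minor n X r"
proof -
  have "det (stack n w (X(k := \<lambda>j. \<Sum>l<n. M k l * X l j))) = M k k * det (stack n w X)"
    if k: "k < n" for k w
  proof -
    have "det (stack n w (X(k := \<lambda>j. \<Sum>l<n. M k l * X l j))) =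
        (\<Sum>l<n. M k l * det (stack n w (X(k := X l))))"
      unfolding det_stack_row_Suc[OF k] sum_distrib_left sum_distrib_right mult.assoc
      by (rule sum.swap)
    also have "\<dots> = (\<Sum>l<n. if l = k then M k k * det (stack n w X) else 0)"
      by (rule sum.cong) (use k det_stack_repeated'[of k n _ w X] in auto)
    finally show ?thesis using k by simp
  qed
  then show ?thesis
    using r by (simp add: dmax_minor_def max_minor_eq sum_distrib_left sum_distrib_right
        mult.left_commute[of _ "(-1) ^ r"])
qed

text \<open>Pairing the vanishing derivatives with row \<open>l\<close> of \<open>X\<close> gives the sum over \<open>k\<close> of the determinants of
  row \<open>l\<close> of \<open>X\<close> on top of \<open>X\<close> with row \<open>k\<close> replaced by row \<open>k\<close> of \<open>Y\<close>. For \<open>k \<noteq> l\<close> a row occurs twice;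
  for \<open>k = l\<close> a transposition of rows yields the determinant of interest up to sign.\<close>

lemma dmax_minor_zero_imp_orthogonal:
  fixes X Y :: "nat \<Rightarrow> nat \<Rightarrow> 'a::comm_ring_1"
  assumes zero: "\<And>r. r < n + 1 \<Longrightarrow> dmax_minor n X Y r = 0" and l: "l < n"
  shows "det (stack n (Y l) X) = 0"
proof -
  have "0 = (\<Sum>r<n + 1. X l r * ((-1) ^ r * dmax_minor n X Y r))"
    using zero by simp
  also have "\<dots> = (\<Sum>k<n. det (stack n (X l) (X(k := Y k))))"
    unfolding det_stack_row_0 dmax_minor_def sum_distrib_left by (rule sum.swap)
  also have "\<dots> = (\<Sum>k<n. if k = l then - det (stack n (Y l) X) else 0)"
  proof (rule sum.cong[OF refl])
    fix k assume "k \<in> {..<n}"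
    show "det (stack n (X l) (X(k := Y k))) = (if k = l then - det (stack n (Y l) X) else 0)"
    proof (cases "k = l")
      case True
      then show ?thesis using det_stack_swap[OF l] by simp
    next
      case False
      then show ?thesis using det_stack_repeated[OF l, of "X(k := Y k)"] by simp
    qed
  qed
  finally show ?thesis using l by simp
qed

lemma orthogonal_imp_minor_times_in_row_space:
  fixes X :: "nat \<Rightarrow> nat \<Rightarrow> 'a::comm_ring_1"
  assumes "det (stack n y X) = 0" "r < n + 1" "j < n + 1"
  shows "max_minor n X r * y j = (\<Sum>k<n. max_minor n (X(k := y)) r * X k j)"
proof -
  have "y j * det (stack n (unit_fun r) X) =
      (\<Sum>k<n. det (stack n (unit_fun r) (X(k := y))) * X k j)"
    using cramer_stack[of j n y "unit_fun r" X] assms by simp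
  then have "(-1) ^ r * (y j * det (stack n (unit_fun r) X)) =
      (\<Sum>k<n. (-1) ^ r * (det (stack n (unit_fun r) (X(k := y))) * X k j))"
    by (simp add: sum_distrib_left)
  then show ?thesis
    using assms(2) by (simp add: max_minor_eq mult_ac)
qed

text \<open>A linear relation among the rows of \<open>X\<close> is a matrix \<open>M\<close> with \<open>M X = 0\<close>; placing the coefficients in
  row \<open>l\<close> of \<open>M\<close>, the derivative in the direction \<open>M X\<close> shows that \<open>tr M = c l\<close> kills the minors.\<close>

lemma row_relation_times_minor:
  fixes X :: "nat \<Rightarrow> nat \<Rightarrow> 'a::comm_ring_1"
  assumes zero: "\<And>j. j < n + 1 \<Longrightarrow> (\<Sum>k<n. c k * X k j) = 0" and l: "l < n" and r: "r < n + 1"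
  shows "c l * max_minor n X r = 0"
proof -
  define M where "M k m = (if k = l then c m else 0)" for k m
  have "(\<Sum>k<n. M k k) = c l" using l by (simp add: M_def)
  moreover have "dmax_minor n X (\<lambda>k j. \<Sum>m<n. M k m * X m j) r = 0"
  proof -
    have "(\<Sum>m<n. M k m * X m j) = 0" if "j < n + 1" for k j
      using zero[OF that] by (cases "k = l") (simp_all add: M_def)
    then show ?thesis
      unfolding dmax_minor_def max_minor_eq[OF r]
      by (auto intro!: sum.neutral simp: det_stack_row_Suc simp del: sum.lessThan_Suc)
  qed
  ultimately show ?thesis using dmax_minor_row_combination[OF r, of X M] by simp
qed

text \<open>The direction has the \<open>j\<close>-th column of \<open>X\<close> in its \<open>i\<close>-th column and is zero elsewhere. It produces the
  elements \<open>F\<^sub>i e\<^sub>j\<close> in the image of the Jacobian matrix.\<close>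

lemma dmax_minor_column_shift:
  fixes X :: "nat \<Rightarrow> nat \<Rightarrow> 'a::comm_ring_1"
  assumes "i < n + 1" "j < n + 1" "r < n + 1"
  shows "dmax_minor n X (\<lambda>k m. if m = i then X k j else 0) r =
    (if i = j then max_minor n X r else 0) - (if r = j then (-1) ^ (r + i) * max_minor n X i else 0)"
proof -
  have "det (stack n w (X(k := \<lambda>m. if m = i then X k j else 0))) =
      det (stack n w (X(k := unit_fun i))) * X k j" if "k < n" for k w
    using that unfolding det_stack_row_Suc[OF that] sum_distrib_right
    by (intro sum.cong) (auto simp: unit_fun_def)
  then have "dmax_minor n X (\<lambda>k m. if m = i then X k j else 0) r =
      (-1) ^ r * (\<Sum>k<n. det (stack n (unit_fun r) (X(k := unit_fun i))) * X k j)"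
    using assms by (simp add: dmax_minor_def max_minor_eq sum_distrib_left)
  also have "(\<Sum>k<n. det (stack n (unit_fun r) (X(k := unit_fun i))) * X k j) =
      unit_fun i j * det (stack n (unit_fun r) X) - det (stack n (unit_fun i) X) * unit_fun r j"
    using cramer_stack[of j n "unit_fun i" "unit_fun r" X] assms by (simp add: algebra_simps)
  finally show ?thesis
    using assms by (auto simp: unit_fun_def max_minor_eq algebra_simps power_add)
qed

section \<open>The polynomial ring, its grading and its derivations\<close>

lemma mpol_ring_simps [simp]:
  "monoid.mult (mpol_ring V) = (*)" "one (mpol_ring V) = 1" "zero (mpol_ring V) = 0" "add (mpol_ring V) = (+)"
  by (simp_all add: mpol_ring_def)

lemma mpol_carrier_iff: "p \<in> carrier (mpol_ring V) \<longleftrightarrow> (\<forall>m\<in>keys p. keys m \<subseteq> V)"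
  by (simp add: mpol_ring_def)

lemma mpol_carrier_basics [simp, intro]:
  "0 \<in> carrier (mpol_ring V)" "1 \<in> carrier (mpol_ring V)"
  "p \<in> carrier (mpol_ring V) \<Longrightarrow> - p \<in> carrier (mpol_ring V)"
  by (simp_all add: mpol_carrier_iff)

lemma mpol_carrier_add [intro]:
  "p \<in> carrier (mpol_ring V) \<Longrightarrow> q \<in> carrier (mpol_ring V) \<Longrightarrow> p + q \<in> carrier (mpol_ring V)"
  using keys_add[of p q] by (fastforce simp: mpol_carrier_iff)

lemma mpol_carrier_diff [intro]:
  "p \<in> carrier (mpol_ring V) \<Longrightarrow> q \<in> carrier (mpol_ring V) \<Longrightarrow> p - q \<in> carrier (mpol_ring V)"
  using mpol_carrier_add[of p V "- q"] by simp

lemma mpol_carrier_mult [intro]: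
  assumes "p \<in> carrier (mpol_ring V)" "q \<in> carrier (mpol_ring V)"
  shows "p * q \<in> carrier (mpol_ring V)"
proof -
  have "keys m \<subseteq> V" if m: "m \<in> keys (p * q)" for m
  proof -
    obtain a b where "m = a + b" "a \<in> keys p" "b \<in> keys q"
      using m keys_mult[of p q] by blast
    then show ?thesis using assms keys_add[of a b] by (fastforce simp: mpol_carrier_iff)
  qed
  then show ?thesis by (simp add: mpol_carrier_iff)
qed

lemma mpol_carrier_sum [intro]:
  "(\<And>x. x \<in> A \<Longrightarrow> f x \<in> carrier (mpol_ring V)) \<Longrightarrow> sum f A \<in> carrier (mpol_ring V)"
  by (induction A rule: infinite_finite_induct) auto

lemma mpol_carrier_prod [intro]:
  "(\<And>x. x \<in> A \<Longrightarrow> f x \<in> carrier (mpol_ring V)) \<Longrightarrow> prod f A \<in> carrier (mpol_ring V)"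
  by (induction A rule: infinite_finite_induct) auto

lemma mpol_carrier_power [intro]:
  "p \<in> carrier (mpol_ring V) \<Longrightarrow> p ^ k \<in> carrier (mpol_ring V)"
  by (induction k) auto

lemma mpol_carrier_mvar [intro]: "v \<in> V \<Longrightarrow> mvar v \<in> carrier (mpol_ring V)"
  by (simp add: mpol_carrier_iff mvar_def)

lemma mpol_carrier_det:
  assumes A: "A \<in> carrier_mat n n"
    and entries: "\<And>i j. i < n \<Longrightarrow> j < n \<Longrightarrow> A $$ (i, j) \<in> carrier (mpol_ring V)"
  shows "det A \<in> carrier (mpol_ring V)"
  unfolding det_def'[OF A]
proof (intro mpol_carrier_sum mpol_carrier_mult mpol_carrier_prod)
  fix p assume p: "p \<in> {p. p permutes {0..<n}}"
  show "signof p \<in> carrier (mpol_ring V)"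
    by (simp add: sign_def)
  show "A $$ (i, p i) \<in> carrier (mpol_ring V)" if "i \<in> {0..<n}" for i
    using p that permutes_in_image[of p "{0..<n}" i] by (auto intro: entries)
qed

lemma cring_mpol_ring: "cring (mpol_ring V :: ('v, 'a::comm_ring_1) mpol ring)"
proof (intro cringI abelian_groupI)
  fix x :: "('v, 'a) mpol" assume "x \<in> carrier (mpol_ring V)"
  then show "\<exists>y\<in>carrier (mpol_ring V). y \<oplus>\<^bsub>mpol_ring V\<^esub> x = \<zero>\<^bsub>mpol_ring V\<^esub>"
    by (intro bexI[of _ "- x"]) auto
qed (auto simp: algebra_simps intro!: comm_monoidI)

lemma monom_degree_superset:
  assumes "finite A" "keys m \<subseteq> A"
  shows "monom_degree m = (\<Sum>v\<in>A. lookup m v)"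
  unfolding monom_degree_def by (rule sum.mono_neutral_left) (use assms in \<open>auto simp: in_keys_iff\<close>)

lemma monom_degree_add: "monom_degree (m + m') = monom_degree m + monom_degree m'"
proof -
  have "finite (keys m \<union> keys m')" "keys (m + m') \<subseteq> keys m \<union> keys m'"
    using keys_add[of m m'] by auto
  then show ?thesis
    using monom_degree_superset[of "keys m \<union> keys m'"] by (simp add: lookup_add sum.distrib)
qed

lemma monom_degree_zero [simp]: "monom_degree 0 = 0"
  by (simp add: monom_degree_def)

lemma monom_degree_single [simp]: "monom_degree (single v k) = k"
  by (simp add: monom_degree_def)

lemma homog_comp_carrier: "p \<in> homog_comp V d \<Longrightarrow> p \<in> carrier (mpol_ring V)"
  by (simp add: homog_comp_def)

lemma homog_comp_zero [simp, intro]: "0 \<in> homog_comp V d"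
  by (simp add: homog_comp_def)

lemma homog_comp_one: "1 \<in> homog_comp V 0"
  by (simp add: homog_comp_def)

lemma homog_comp_uminus: "p \<in> homog_comp V d \<Longrightarrow> - p \<in> homog_comp V d"
  by (simp add: homog_comp_def)

lemma homog_comp_add: "p \<in> homog_comp V d \<Longrightarrow> q \<in> homog_comp V d \<Longrightarrow> p + q \<in> homog_comp V d"
  using keys_add[of p q] by (auto simp: homog_comp_def)

lemma homog_comp_sum:
  "(\<And>x. x \<in> A \<Longrightarrow> f x \<in> homog_comp V d) \<Longrightarrow> sum f A \<in> homog_comp V d"
  by (induction A rule: infinite_finite_induct) (auto intro: homog_comp_add)

lemma homog_comp_mult:
  assumes "p \<in> homog_comp V c" "q \<in> homog_comp V d"
  shows "p * q \<in> homog_comp V (c + d)"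
proof -
  have "int (monom_degree m) = c + d" if "m \<in> keys (p * q)" for m
    using that keys_mult[of p q] assms by (fastforce simp: homog_comp_def monom_degree_add)
  then show ?thesis using assms by (auto simp: homog_comp_def)
qed

lemma homog_comp_prod:
  assumes "finite A" "\<And>x. x \<in> A \<Longrightarrow> f x \<in> homog_comp V 1"
  shows "prod f A \<in> homog_comp V (int (card A))"
  using assms
proof (induction A rule: finite_induct)
  case (insert x A)
  then show ?case using homog_comp_mult[of "f x" V 1 "prod f A" "int (card A)"] by simp
qed (simp add: homog_comp_one)

lemma homog_comp_mvar: "v \<in> V \<Longrightarrow> mvar v \<in> homog_comp V 1"
  using mpol_carrier_mvar[of v V] by (simp add: homog_comp_def) (simp add: mvar_def)

lemma homog_comp_det:
  assumes A: "A \<in> carrier_mat n n"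
    and entries: "\<And>i j. i < n \<Longrightarrow> j < n \<Longrightarrow> A $$ (i, j) \<in> homog_comp V 1"
  shows "det A \<in> homog_comp V (int n)"
  unfolding det_def'[OF A]
proof (rule homog_comp_sum)
  fix p assume p: "p \<in> {p. p permutes {0..<n}}"
  have "(\<Prod>i=0..<n. A $$ (i, p i)) \<in> homog_comp V (int (card {0..<n}))"
    by (rule homog_comp_prod)
      (use p permutes_in_image[of p "{0..<n}"] in \<open>auto intro!: entries\<close>)
  then show "signof p * (\<Prod>i=0..<n. A $$ (i, p i)) \<in> homog_comp V (int n)"
    using homog_comp_uminus by (auto simp: sign_def)
qed

text \<open>Every monomial of positive degree is divisible by a variable.\<close>

lemma homog_max_idealI:
  assumes "p \<in> homog_comp V d" "d > 0"
  shows "p \<in> homog_max_ideal V"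
proof -
  interpret Q: cring "mpol_ring V :: ('a, 'b) mpol ring" by (rule cring_mpol_ring)
  have sub: "(mvar ` V :: ('a, 'b) mpol set) \<subseteq> carrier (mpol_ring V)" by auto
  interpret I: ideal "homog_max_ideal V :: ('a, 'b) mpol set" "mpol_ring V"
    unfolding homog_max_ideal_def by (rule Q.genideal_ideal[OF sub])
  have mon: "single m c \<in> homog_max_ideal V" if m: "m \<in> keys p" for m and c :: 'b
  proof -
    have "monom_degree m \<noteq> 0" using m assms by (auto simp: homog_comp_def)
    then obtain v where v: "v \<in> keys m" unfolding monom_degree_def by fastforce
    have "m = single v 1 + (m - single v 1)"
      by (rule poly_mapping_eqI) (use v in \<open>auto simp: lookup_add lookup_minus lookup_single when_def in_keys_iff\<close>)
    then have eq: "single m c = single (m - single v 1) c * mvar v"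
      by (simp add: mvar_def mult_single add.commute)
    have V: "keys m \<subseteq> V" using m assms by (simp add: homog_comp_def mpol_carrier_iff)
    have "keys (m - single v 1) \<subseteq> keys m"
      by (auto simp: in_keys_iff lookup_minus)
    then have "single (m - single v 1) c \<in> carrier (mpol_ring V)"
      using V by (auto simp: mpol_carrier_iff)
    moreover have "(mvar v :: ('a, 'b) mpol) \<in> homog_max_ideal V"
      using Q.genideal_self[OF sub] v V unfolding homog_max_ideal_def by auto
    ultimately show ?thesis using I.I_l_closed unfolding eq by fastforce
  qed
  have "sum (\<lambda>m. single m (lookup p m)) A \<in> homog_max_ideal V" if "A \<subseteq> keys p" for A
    using finite_subset[OF that finite_keys] that
  proof (induction A rule: finite_induct)
    case (insert m A)
    then show ?case using I.a_closed[OF mon[of m "lookup p m"]] by simp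
  qed (use I.zero_closed in simp)
  then show ?thesis using sum_single[of p] by (metis subset_refl)
qed

text \<open>The coefficients of the derivative, from which its linearity and its effect on degrees are immediate.\<close>

lemma lookup_partial_deriv:
  "lookup (partial_deriv v p) m = of_nat (lookup m v + 1) * lookup p (m + single v 1)"
proof -
  have "lookup (single (m' - single v 1) (of_nat (lookup m' v) * lookup p m')) m =
      (if m' = m + single v 1 then of_nat (lookup m v + 1) * lookup p m' else 0)" for m'
  proof (cases "lookup m' v = 0")
    case True
    then have "m' \<noteq> m + single v 1" by (auto simp: lookup_add)
    then show ?thesis using True by simp
  next
    case False
    then have "m' = (m' - single v 1) + single v 1"
      by (intro poly_mapping_eqI) (auto simp: lookup_add lookup_minus lookup_single when_def)
    then have "m' - single v 1 = m \<longleftrightarrow> m' = m + single v 1"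
      by (metis add_diff_cancel_right')
    then show ?thesis by (auto simp: lookup_single when_def lookup_add)
  qed
  then show ?thesis
    by (simp add: partial_deriv_def lookup_sum in_keys_iff)
qed

lemma partial_deriv_sum: "partial_deriv v (sum f A) = (\<Sum>x\<in>A. partial_deriv v (f x))"
  by (rule poly_mapping_eqI) (simp add: lookup_partial_deriv lookup_sum sum_distrib_left)

text \<open>The one instance of the Leibniz rule that is needed: a minor is linear in the variables of each row.\<close>

lemma partial_deriv_mvar_mult:
  fixes q :: "('v, 'a::comm_ring_1) mpol"
  assumes q: "q \<in> carrier (mpol_ring V)" and v: "v \<notin> V"
  shows "partial_deriv v (mvar w * q) = (if w = v then q else 0)"
proof (rule poly_mapping_eqI)
  fix m
  show "lookup (partial_deriv v (mvar w * q)) m = lookup (if w = v then q else 0) m"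
  proof (cases "w = v")
    case True
    have "lookup (mvar v * q) (m + single v 1) = lookup q m"
      using lookup_single_mult[of "single v 1" q m] by (simp add: mvar_def add.commute)
    moreover have "lookup m v = 0" if "lookup q m \<noteq> 0"
      using that q v by (metis in_keys_iff mpol_carrier_iff subsetD)
    ultimately show ?thesis
      using True by (cases "lookup q m = 0") (simp_all add: lookup_partial_deriv)
  next
    case False
    have "m + single v 1 \<notin> keys (mvar w * q)"
    proof
      assume "m + single v 1 \<in> keys (mvar w * q)"
      then obtain m' where "m + single v 1 = single w 1 + m'" "m' \<in> keys q"
        unfolding mvar_def keys_single_mult by auto
      moreover from this(1) have "lookup m v + 1 = lookup m' v"
        using False by (metis (no_types, lifting) lookup_add lookup_single_eq lookup_single_not_eq add_0)
      ultimately have "v \<in> keys m'" "m' \<in> keys q"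
        by (auto simp: in_keys_iff)
      then show False using q v by (auto simp: mpol_carrier_iff)
    qed
    then show ?thesis using False by (simp add: lookup_partial_deriv in_keys_iff)
  qed
qed

lemma homog_comp_partial_deriv:
  assumes "p \<in> homog_comp V d"
  shows "partial_deriv v p \<in> homog_comp V (d - 1)"
proof -
  have *: "m + single v 1 \<in> keys p" if "m \<in> keys (partial_deriv v p)" for m
    using that by (auto simp: in_keys_iff lookup_partial_deriv)
  have "keys m \<subseteq> V \<and> int (monom_degree m) = d - 1" if "m \<in> keys (partial_deriv v p)" for m
  proof -
    have "keys (m + single v 1) \<subseteq> V" "int (monom_degree (m + single v 1)) = d"
      using *[OF that] assms by (auto simp: homog_comp_def mpol_carrier_iff)
    moreover have "keys m \<subseteq> keys (m + single v 1)"
      by (auto simp: in_keys_iff lookup_add)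
    ultimately show ?thesis by (auto simp: monom_degree_add)
  qed
  then show ?thesis by (simp add: homog_comp_def mpol_carrier_iff)
qed

section \<open>The generic matrix\<close>

abbreviation X_fun :: "nat \<Rightarrow> nat \<Rightarrow> 'a::field gpol" where
  "X_fun k j \<equiv> mvar (k, j)"

lemma minor_eq: "minor n r = max_minor n X_fun r"
  unfolding minor_def max_minor_def
  by (rule arg_cong[where f = det], rule eq_matI)
    (auto simp: generic_mat_def insert_index_def)

text \<open>In this weight the identity permutation gives the unique heaviest term both of the minor without the
  last column and of the minor without the first one. The other variables have weight \<open>0\<close>.\<close>

definition diag_weight :: "nat \<Rightarrow> (nat \<times> nat \<Rightarrow>\<^sub>0 nat) \<Rightarrow> nat" where
  "diag_weight n m = (\<Sum>i<n. lookup m (i, i) + lookup m (i, i + 1))"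

lemma diag_weight_add: "diag_weight n (m + m') = diag_weight n m + diag_weight n m'"
  by (simp add: diag_weight_def lookup_add sum.distrib)

lemma diag_weight_sum: "diag_weight n (sum f A) = (\<Sum>x\<in>A. diag_weight n (f x))"
  by (induction A rule: infinite_finite_induct) (simp_all add: diag_weight_add, simp_all add: diag_weight_def)

lemma diag_weight_single:
  "i < n \<Longrightarrow> diag_weight n (single (i, j) 1) = (if j = i \<or> j = i + 1 then 1 else 0)"
proof -
  assume i: "i < n"
  have "diag_weight n (single (i, j) 1) =
      (\<Sum>k<n. if k = i then (if j = i \<or> j = i + 1 then 1 else 0) else 0)"
    unfolding diag_weight_def by (rule sum.cong) (auto simp: lookup_single when_def)
  then show ?thesis using i by simp
qed

lemma prod_mvar: "(\<Prod>i\<in>A. mvar (f i)) = single (\<Sum>i\<in>A. single (f i) 1) (1::'a::comm_ring_1)"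
  by (induction A rule: infinite_finite_induct) (simp_all add: mvar_def mult_single)

text \<open>The term of the determinant for a permutation \<open>p\<close> is a monomial in which row \<open>i\<close> contributes weight \<open>1\<close>
  or \<open>0\<close>; by assumption some row contributes \<open>0\<close> as soon as \<open>p\<close> is not the identity.\<close>

lemma det_leading_monomial:
  fixes g :: "nat \<Rightarrow> nat"
  assumes perm: "\<And>p. p permutes {0..<n} \<Longrightarrow> p \<noteq> id \<Longrightarrow> \<exists>i<n. g (p i) \<noteq> i \<and> g (p i) \<noteq> i + 1"
  shows "\<exists>L :: 'a::field gpol.
    det (mat n n (\<lambda>(i, j). mvar (i, g j))) = single (\<Sum>i<n. single (i, g i) 1) 1 + L \<and>
    (\<forall>m\<in>keys L. diag_weight n m < n)"
proof -
  let ?P = "{p. p permutes {0..<n}}"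
  let ?t = "\<lambda>p. signof p * (\<Prod>i=0..<n. (mvar (i, g (p i)) :: 'a gpol))"
  have "det (mat n n (\<lambda>(i, j). (mvar (i, g j) :: 'a gpol))) = (\<Sum>p\<in>?P. ?t p)"
    by (subst det_def'[where n = n]) (auto intro!: sum.cong prod.cong simp: permutes_in_image)
  also have "\<dots> = ?t id + (\<Sum>p\<in>?P - {id}. ?t p)"
    by (rule sum.remove) (simp_all add: finite_permutations permutes_id)
  also have "?t id = single (\<Sum>i<n. single (i, g i) 1) 1"
    by (simp add: prod_mvar atLeast0LessThan)
  finally have "det (mat n n (\<lambda>(i, j). (mvar (i, g j) :: 'a gpol))) =
      single (\<Sum>i<n. single (i, g i) 1) 1 + (\<Sum>p\<in>?P - {id}. ?t p)" .
  moreover have "diag_weight n m < n" if rest: "m \<in> keys (\<Sum>p\<in>?P - {id}. ?t p)" for m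
  proof -
    obtain p where p: "p permutes {0..<n}" "p \<noteq> id" and m: "m \<in> keys (?t p)"
      using rest keys_sum[of ?t "?P - {id}"] by blast
    have "keys (?t p) \<subseteq> {\<Sum>i=0..<n. single (i, g (p i)) 1}"
      unfolding prod_mvar by (auto simp: sign_def)
    then have "diag_weight n m = (\<Sum>i<n. diag_weight n (single (i, g (p i)) 1))"
      using m by (auto simp: diag_weight_sum atLeast0LessThan)
    also have "\<dots> < (\<Sum>i<n. 1)"
    proof (rule sum_strict_mono_ex1)
      show "\<exists>i\<in>{..<n}. diag_weight n (single (i, g (p i)) 1) < 1"
        using perm[OF p] by (auto simp: diag_weight_single simp del: One_nat_def)
    qed (simp_all add: diag_weight_single del: One_nat_def)
    finally show ?thesis by simp
  qed
  ultimately show ?thesis by blast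
qed

text \<open>A permutation other than the identity moves some \<open>i\<close> to the left, out of the two diagonals.\<close>

lemma minor_last_leading:
  shows "\<exists>L :: 'a::field gpol. minor n n = single (\<Sum>i<n. single (i, i) 1) 1 + L \<and>
    (\<forall>m\<in>keys L. diag_weight n m < n)"
proof -
  have "\<exists>i<n. p i \<noteq> i \<and> p i \<noteq> i + 1" if p: "p permutes {0..<n}" "p \<noteq> id" for p
  proof -
    obtain i where "i < n" "p i < i"
      using permutes_natset_ge[OF p(1)] p(2) by (meson atLeastLessThan_iff not_le)
    then show ?thesis by (intro exI[of _ i]) simp
  qed
  then have "\<exists>L :: 'a gpol.
      det (mat n n (\<lambda>(i, j). mvar (i, j))) = single (\<Sum>i<n. single (i, i) 1) 1 + L \<and>
      (\<forall>m\<in>keys L. diag_weight n m < n)"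
    by (rule det_leading_monomial)
  moreover have "minor n n = det (mat n n (\<lambda>(i, j). (mvar (i, j) :: 'a gpol)))"
    unfolding minor_eq max_minor_def by (rule arg_cong[where f = det], rule eq_matI) auto
  ultimately show ?thesis by simp
qed

text \<open>A permutation other than the identity moves some \<open>i\<close> to the right; since the columns are shifted by one,
  this again leaves the two diagonals.\<close>

lemma minor_0_leading:
  shows "\<exists>L :: 'a::field gpol. minor n 0 = single (\<Sum>i<n. single (i, i + 1) 1) 1 + L \<and>
    (\<forall>m\<in>keys L. diag_weight n m < n)"
proof -
  have "\<exists>i<n. Suc (p i) \<noteq> i \<and> Suc (p i) \<noteq> i + 1" if p: "p permutes {0..<n}" "p \<noteq> id" for p
  proof -
    obtain i where "i < n" "i < p i"
      using permutes_natset_le[OF p(1)] p(2) by (meson atLeastLessThan_iff not_le)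
    then show ?thesis by (intro exI[of _ i]) simp
  qed
  then have "\<exists>L :: 'a gpol.
      det (mat n n (\<lambda>(i, j). mvar (i, Suc j))) = single (\<Sum>i<n. single (i, Suc i) 1) 1 + L \<and>
      (\<forall>m\<in>keys L. diag_weight n m < n)"
    by (rule det_leading_monomial)
  moreover have "minor n 0 = det (mat n n (\<lambda>(i, j). (mvar (i, Suc j) :: 'a gpol)))"
    unfolding minor_eq max_minor_def by (rule arg_cong[where f = det], rule eq_matI) auto
  ultimately show ?thesis by simp
qed

lemma minor_last_nonzero: "(minor n n :: 'a::field gpol) \<noteq> 0"
proof -
  obtain L :: "'a gpol" where L: "minor n n = single (\<Sum>i<n. single (i, i) 1) 1 + L"
    "\<And>m. m \<in> keys L \<Longrightarrow> diag_weight n m < n"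
    using minor_last_leading[of n, where 'a = 'a] by blast
  have "diag_weight n (\<Sum>i<n. single (i, i) 1) = n"
    by (simp add: diag_weight_sum diag_weight_single del: One_nat_def)
  then have "(\<Sum>i<n. single (i, i) 1) \<notin> keys L" using L(2) by fastforce
  then have "lookup (minor n n :: 'a gpol) (\<Sum>i<n. single (i, i) 1) = 1"
    by (simp add: L(1) lookup_add in_keys_iff)
  then show ?thesis by auto
qed

lemma minors_coprime:
  fixes a b :: "'a::field gpol"
  assumes "minor n 0 * a = minor n n * b"
  shows "\<exists>c. a = minor n n * c"
proof -
  obtain L :: "'a gpol" where L: "minor n 0 = single (\<Sum>i<n. single (i, i + 1) 1) 1 + L"
    "\<And>m. m \<in> keys L \<Longrightarrow> diag_weight n m < n"
    using minor_0_leading[of n, where 'a = 'a] by blast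
  obtain K :: "'a gpol" where K: "minor n n = single (\<Sum>i<n. single (i, i) 1) 1 + K"
    "\<And>m. m \<in> keys K \<Longrightarrow> diag_weight n m < n"
    using minor_last_leading[of n, where 'a = 'a] by blast
  have keys: "keys (\<Sum>i<n. single (i, f i) (1::nat)) \<subseteq> (\<lambda>i. (i, f i)) ` {..<n}" for f :: "nat \<Rightarrow> nat"
    by (auto simp: in_keys_iff lookup_sum lookup_single when_def split: if_splits)
  show ?thesis
  proof (rule coprime_leading_monomials[OF diag_weight_add L _ K _ _ assms])
    show "keys (\<Sum>i<n. single (i, i + 1) (1::nat)) \<inter> keys (\<Sum>i<n. single (i, i) (1::nat)) = {}"
      using keys[of "\<lambda>i. i + 1"] keys[of "\<lambda>i. i"] by fastforce
  qed (simp_all add: diag_weight_sum diag_weight_single del: One_nat_def)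
qed

lemma row_relation_trivial:
  fixes c :: "nat \<Rightarrow> 'a::field gpol"
  assumes "\<And>j. j < n + 1 \<Longrightarrow> (\<Sum>k<n. c k * X_fun k j) = 0" and "l < n"
  shows "c l = 0"
  using row_relation_times_minor[of n c X_fun l n] assms minor_last_nonzero[of n, where 'a = 'a]
  by (simp add: minor_eq)

text \<open>Over the field of fractions the coefficients of \<open>y\<close> are unique, and Cramer's rule writes them as
  fractions with denominator \<open>F\<^sub>0\<close> as well as with denominator \<open>F\<^sub>n\<close>. As these are coprime, the
  coefficients are polynomials. This is the exactness of the Hilbert--Burch complex of \<open>X\<close>.\<close>

lemma orthogonal_imp_row_space:
  fixes y :: "nat \<Rightarrow> 'a::field gpol"
  assumes orth: "det (stack n y X_fun) = 0"
  shows "\<exists>c. \<forall>j<n + 1. y j = (\<Sum>k<n. c k * X_fun k j)"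
proof -
  define a where "a r k = max_minor n (X_fun(k := y)) r" for r k
  have a: "minor n r * y j = (\<Sum>k<n. a r k * X_fun k j)" if "r < n + 1" "j < n + 1" for r j
    using orthogonal_imp_minor_times_in_row_space[OF orth that] by (simp add: a_def minor_eq)
  \<comment> \<open>Both families, multiplied by the other minor, express \<open>F\<^sub>0 F\<^sub>n y\<close>, and the rows of \<open>X\<close> are independent.\<close>
  have "minor n 0 * a n k - minor n n * a 0 k = 0" if "k < n" for k
  proof (rule row_relation_trivial[OF _ that])
    fix j assume j: "j < n + 1"
    have "(\<Sum>k<n. (minor n 0 * a n k - minor n n * a 0 k) * X_fun k j) =
        minor n 0 * (\<Sum>k<n. a n k * X_fun k j) - minor n n * (\<Sum>k<n. a 0 k * X_fun k j)"
      by (simp add: algebra_simps sum_distrib_left sum_subtractf)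
    also have "\<dots> = 0"
      using j by (simp add: mult.left_commute flip: a)
    finally show "(\<Sum>k<n. (minor n 0 * a n k - minor n n * a 0 k) * X_fun k j) = 0" .
  qed
  then have "\<exists>c. a n k = minor n n * c" if "k < n" for k
    using that by (intro minors_coprime) auto
  then obtain c where c: "\<And>k. k < n \<Longrightarrow> a n k = minor n n * c k" by metis
  have "y j = (\<Sum>k<n. c k * X_fun k j)" if "j < n + 1" for j
  proof -
    have "minor n n * y j = minor n n * (\<Sum>k<n. c k * X_fun k j)"
      using a[of n j] that c by (simp add: sum_distrib_left mult.assoc)
    then show ?thesis using minor_last_nonzero[of n, where 'a = 'a] by simp
  qed
  then show ?thesis by blast
qed

lemma max_minor_cong:
  assumes "\<And>k j. k < n \<Longrightarrow> j < n + 1 \<Longrightarrow> Z k j = Z' k j"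
  shows "max_minor n Z r = max_minor n Z' r"
  unfolding max_minor_def
  by (rule arg_cong[where f = det], rule eq_matI) (use assms in \<open>auto simp: insert_index_def\<close>)

lemma dmax_minor_cong:
  assumes "\<And>k j. k < n \<Longrightarrow> j < n + 1 \<Longrightarrow> Y k j = Y' k j"
  shows "dmax_minor n X Y r = dmax_minor n X Y' r"
  unfolding dmax_minor_def
  by (rule sum.cong[OF refl], rule max_minor_cong) (use assms in auto)

text \<open>The rows of \<open>Y\<close> lie in the row space of \<open>X\<close>, so \<open>Y = M X\<close>, and the derivative in this direction is
  \<open>tr M\<close> times the minors. The coefficients found in this way may involve further variables, so they are
  truncated to the polynomial ring in the entries of \<open>X\<close>; this changes neither \<open>M X\<close> nor the zero trace.\<close>

lemma dmax_minor_kernel: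
  fixes Y :: "nat \<Rightarrow> nat \<Rightarrow> 'a::field gpol"
  assumes zero: "\<And>r. r < n + 1 \<Longrightarrow> dmax_minor n X_fun Y r = 0"
    and Y: "\<And>k j. k < n \<Longrightarrow> j < n + 1 \<Longrightarrow> Y k j \<in> carrier (Q_ring n)"
  shows "\<exists>M. (\<forall>k l. M k l \<in> carrier (Q_ring n)) \<and>
    (\<forall>k<n. \<forall>j<n + 1. Y k j = (\<Sum>l<n. M k l * X_fun l j)) \<and> (\<Sum>k<n. M k k) = 0"
proof -
  have "\<exists>c. \<forall>j<n + 1. Y k j = (\<Sum>l<n. c l * X_fun l j)" if "k < n" for k
    using dmax_minor_zero_imp_orthogonal[OF zero that] by (rule orthogonal_imp_row_space)
  then have "\<forall>k. \<exists>c. k < n \<longrightarrow> (\<forall>j<n + 1. Y k j = (\<Sum>l<n. c l * X_fun l j))"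
    by blast
  then obtain M where "\<forall>k. k < n \<longrightarrow> (\<forall>j<n + 1. Y k j = (\<Sum>l<n. M k l * X_fun l j))"
    unfolding choice_iff by blast
  then have M: "\<And>k j. k < n \<Longrightarrow> j < n + 1 \<Longrightarrow> Y k j = (\<Sum>l<n. M k l * X_fun l j)"
    by blast
  have "(\<Sum>k<n. M k k) * minor n n = dmax_minor n X_fun Y n"
  proof -
    have "dmax_minor n X_fun Y n = dmax_minor n X_fun (\<lambda>k j. \<Sum>l<n. M k l * X_fun l j) n"
      by (rule dmax_minor_cong) (rule M)
    then show ?thesis by (simp only: dmax_minor_row_combination minor_eq less_add_one)
  qed
  then have tr: "(\<Sum>k<n. M k k) = 0"
    unfolding zero[OF less_add_one] mult_eq_0_iff using minor_last_nonzero[of n, where 'a = 'a] by blast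
  let ?S = "{m. keys m \<subseteq> gvars n} :: (nat \<times> nat \<Rightarrow>\<^sub>0 nat) set"
  have restrict: "mon_part ?S (p * X_fun l j) = mon_part ?S p * X_fun l j"
    if "l < n" "j < n + 1" for p :: "'a gpol" and l j
  proof -
    have "keys (m + m') = keys m \<union> keys m'" for m m' :: "nat \<times> nat \<Rightarrow>\<^sub>0 nat"
      by (auto simp: set_eq_iff in_keys_iff lookup_add)
    then have "mon_part ?S (X_fun l j * p) = X_fun l j * mon_part ?S p"
      using that by (intro mon_part_mult) (simp add: mvar_def gvars_def)
    then show ?thesis by (simp add: mult.commute)
  qed
  show ?thesis
  proof (intro exI[of _ "\<lambda>k l. mon_part ?S (M k l)"] conjI allI impI)
    show "mon_part ?S (M k l) \<in> carrier (Q_ring n)" for k l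
      by (auto simp: Q_ring_def mpol_carrier_iff keys_mon_part)
    show "Y k j = (\<Sum>l<n. mon_part ?S (M k l) * X_fun l j)" if "k < n" "j < n + 1" for k j
    proof -
      have "Y k j = mon_part ?S (Y k j)"
        by (rule mon_part_id[symmetric]) (use Y[OF that] in \<open>auto simp: Q_ring_def mpol_carrier_iff\<close>)
      then show ?thesis using M[OF that] that by (simp add: mon_part_sum restrict)
    qed
    show "(\<Sum>k<n. mon_part ?S (M k k)) = 0"
      using tr by (simp add: mon_part_zero flip: mon_part_sum)
  qed
qed

section \<open>The matrices of the resolution\<close>

lemma sum_blocks:
  fixes f :: "nat \<Rightarrow> 'a::comm_monoid_add"
  shows "(\<Sum>c<a * b. f c) = (\<Sum>k<a. \<Sum>i<b. f (k * b + i))"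
  by (simp add: sum.atLeastLessThan_shift_0 atLeast0LessThan flip: sum.nat_group)

lemma sum_lessThan_add:
  fixes f :: "nat \<Rightarrow> 'a::comm_monoid_add"
  shows "(\<Sum>c<a + b. f c) = (\<Sum>c<a. f c) + (\<Sum>c<b. f (a + c))"
  by (induction b) (simp_all add: add.assoc)

lemma sum_insert_index:
  fixes f :: "nat \<Rightarrow> 'a::comm_monoid_add"
  assumes "k < n"
  shows "(\<Sum>l<n. f l) = f k + (\<Sum>q<n - 1. f (insert_index k q))"
proof -
  have "insert_index k ` {..<n - 1} = {..<n} - {k}"
    using insert_index_image[of k "n - 1"] assms by (simp add: atLeast0LessThan)
  then have "(\<Sum>l\<in>{..<n} - {k}. f l) = (\<Sum>q<n - 1. f (insert_index k q))"
    by (metis sum.reindex_cong insert_index_inj_on)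
  then show ?thesis using assms by (simp add: sum.remove[of "{..<n}" k])
qed

lemma block_index_less:
  fixes k a b i :: nat
  assumes "k < a" "i < b"
  shows "k * b + i < a * b"
proof -
  have "k * b + i < Suc k * b" using assms by simp
  also have "\<dots> \<le> a * b" using assms by (intro mult_le_mono1) simp
  finally show ?thesis .
qed

lemma block_index_div_mod:
  fixes k b i :: nat
  assumes "i < b"
  shows "(k * b + i) div b = k" "(k * b + i) mod b = i"
  using assms by simp_all

lemma block_index_obtain:
  fixes c a b :: nat
  assumes "c < a * b"
  obtains k i where "k < a" "i < b" "c = k * b + i"
proof
  show "c div b < a" "c mod b < b" "c = c div b * b + c mod b"
    using assms by (auto simp: less_mult_imp_div_less intro!: mod_less_divisor) (cases b, auto)
qed

text \<open>For blocks of equal size the block structure is visible in the quotients and remainders of the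
  indices.\<close>

lemma diag_block_mat_uniform:
  assumes "\<And>A. A \<in> set As \<Longrightarrow> A \<in> carrier_mat a b" "k < length As" "k' < length As" "i < a" "j < b"
  shows "diag_block_mat As $$ (k * a + i, k' * b + j) = (if k = k' then As ! k $$ (i, j) else 0)"
  using assms
proof (induction As arbitrary: k k')
  case (Cons A As)
  have A: "dim_row A = a" "dim_col A = b" using Cons.prems(1)[of A] by auto
  have "map dim_row As = map (\<lambda>_. a) As" "map dim_col As = map (\<lambda>_. b) As"
    using Cons.prems(1) by auto
  then have D: "dim_row (diag_block_mat As) = length As * a" "dim_col (diag_block_mat As) = length As * b"
    unfolding dim_diag_block_mat by (simp_all only: sum_list_triv of_nat_id)
  have idx: "k * a + i < Suc (length As) * a" "k' * b + j < Suc (length As) * b"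
    using Cons.prems by (simp_all only: block_index_less length_Cons)
  have IH: "diag_block_mat As $$ (m * a + i, m' * b + j) = (if m = m' then As ! m $$ (i, j) else 0)"
    if "m < length As" "m' < length As" for m m'
    using Cons.IH[of m m'] Cons.prems that by simp
  show ?case
    using idx Cons.prems A D IH
    by (cases k; cases k') (auto simp: Let_def)
qed simp

text \<open>Expanding the bordered determinant along row \<open>k + 1\<close> writes the minor as a linear form in the variables
  \<open>(k, j)\<close> whose coefficients are free of these variables; the cofactors are the derivatives.\<close>

lemma J_Q_entry:
  assumes r: "r < n + 1" and k: "k < n" and i: "i < n + 1"
  shows "(J_Q n :: 'a::field gpol mat) $$ (r, k * (n + 1) + i) =
    (-1) ^ r * cofactor (stack n (unit_fun r) X_fun) (k + 1) i"
proof -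
  let ?q = "\<lambda>i. (-1) ^ r * cofactor (stack n (unit_fun r) X_fun) (k + 1) i :: 'a gpol"
  let ?V = "{v. fst v \<noteq> k} :: (nat \<times> nat) set"
  have q: "?q j \<in> carrier (mpol_ring ?V)" for j
  proof -
    have "det (mat_delete (stack n (unit_fun r) X_fun) (k + 1) j :: 'a gpol mat) \<in> carrier (mpol_ring ?V)"
    proof (rule mpol_carrier_det)
      fix a b assume "a < n" "b < n"
      then show "mat_delete (stack n (unit_fun r) X_fun) (k + 1) j $$ (a, b) \<in> carrier (mpol_ring ?V)"
        by (auto simp: mat_delete_def stack_def unit_fun_def intro!: mpol_carrier_mvar)
    qed (simp add: mat_delete_def stack_def)
    then show ?thesis unfolding cofactor_def
      by (intro mpol_carrier_mult mpol_carrier_power) auto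
  qed
  have pd: "partial_deriv (k, i) (mvar (k, j) * ?q j) = (if j = i then ?q i else 0)" for j
    by (subst partial_deriv_mvar_mult[OF q]) auto
  have "minor n r = (-1) ^ r * det (stack n (unit_fun r) (X_fun(k := X_fun k)))"
    unfolding minor_eq max_minor_eq[OF r] by (rule arg_cong[where f = "\<lambda>Z. _ * det (stack n _ Z)"]) auto
  also have "\<dots> = (\<Sum>j<n + 1. mvar (k, j) * ?q j)"
    unfolding det_stack_row_Suc[OF k] sum_distrib_left by (simp add: mult.left_commute)
  finally have "partial_deriv (k, i) (minor n r :: 'a gpol) = (\<Sum>j<n + 1. if j = i then ?q i else 0)"
    by (simp only: partial_deriv_sum pd)
  moreover have "(J_Q n :: 'a gpol mat) $$ (r, k * (n + 1) + i) = partial_deriv (k, i) (minor n r)"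
    unfolding J_Q_def index_mat(1)[OF r block_index_less[OF k i]]
    by (simp only: case_prod_conv block_index_div_mod[OF i])
  ultimately show ?thesis using i by (simp del: sum.lessThan_Suc)
qed

lemma J_Q_mult_vec:
  fixes y :: "'a::field gpol vec"
  assumes y: "y \<in> carrier_vec (n * (n + 1))" and r: "r < n + 1"
  shows "(J_Q n *\<^sub>v y) $ r = dmax_minor n X_fun (\<lambda>k j. y $ (k * (n + 1) + j)) r"
proof -
  have "(J_Q n *\<^sub>v y) $ r = (\<Sum>c<n * (n + 1). J_Q n $$ (r, c) * y $ c)"
    using y r by (simp add: J_Q_def scalar_prod_def atLeast0LessThan)
  also have "\<dots> = (\<Sum>k<n. \<Sum>i<n + 1.
      (-1) ^ r * cofactor (stack n (unit_fun r) X_fun) (k + 1) i * y $ (k * (n + 1) + i))"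
    unfolding sum_blocks using r by (intro sum.cong refl) (subst J_Q_entry, auto)
  also have "\<dots> = dmax_minor n X_fun (\<lambda>k j. y $ (k * (n + 1) + j)) r"
    unfolding dmax_minor_def max_minor_eq[OF r]
    by (intro sum.cong refl)
      (simp add: det_stack_row_Suc sum_distrib_left mult_ac del: sum.lessThan_Suc)
  finally show ?thesis .
qed

lemma J_Q_carrier: "J_Q n \<in> carrier_mat (n + 1) (n * (n + 1))"
  by (simp add: J_Q_def)

lemma A_block_carrier: "A_block n k \<in> carrier_mat (n + 1) (n - 1)"
  by (simp add: A_block_def)

lemma A_block_entry:
  "k < n \<Longrightarrow> i < n + 1 \<Longrightarrow> q < n - 1 \<Longrightarrow> A_block n k $$ (i, q) = mvar (insert_index k q, i)"
  by (simp add: A_block_def generic_mat_def insert_index_def)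

lemma B_col_entry:
  assumes l: "0 < l" "l < n" and k: "k < n" and j: "j < n + 1"
  shows "(B_col n l :: 'a::field gpol vec) $ (k * (n + 1) + j) =
    (if k = 0 then - X_fun 0 j else if k = l then X_fun l j else 0)"
proof -
  have idx: "k * (n + 1) + j < n * (n + 1)" using block_index_less[OF k j] .
  have eq: "k * (n + 1) + j = m * (n + 1) + s \<longleftrightarrow> k = m \<and> j = s" if "s < n + 1" for m s
    using that j by (metis div_mult_self3 div_less mod_mult_self3 mod_less add_0_right
        Suc_eq_plus1 nat.distinct(1))
  have "(B_col n l :: 'a gpol vec) $ (k * (n + 1) + j) = (\<Sum>s<n + 1.
      (if k = 0 \<and> j = s then - X_fun 0 s else 0) + (if k = l \<and> j = s then X_fun l s else 0))"
    unfolding B_col_def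
  proof (subst index_finsum_vec[OF _ idx])
    show "(\<Sum>s<n + 1. ((- generic_mat n $$ (0, s)) \<cdot>\<^sub>v unit_vec (n * (n + 1)) s +
        generic_mat n $$ (l, s) \<cdot>\<^sub>v unit_vec (n * (n + 1)) (l * (n + 1) + s)) $ (k * (n + 1) + j)) =
      (\<Sum>s<n + 1. (if k = 0 \<and> j = s then - X_fun 0 s else 0) + (if k = l \<and> j = s then X_fun l s else 0))"
    proof (rule sum.cong[OF refl])
      fix s assume "s \<in> {..<n + 1}"
      then have s: "s < n + 1" by simp
      have "s < n * (n + 1)" "l * (n + 1) + s < n * (n + 1)"
        using block_index_less[of 0 n s "n + 1"] block_index_less[OF l(2) s] l s by simp_all
      then show "((- generic_mat n $$ (0, s)) \<cdot>\<^sub>v unit_vec (n * (n + 1)) s +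
          generic_mat n $$ (l, s) \<cdot>\<^sub>v unit_vec (n * (n + 1)) (l * (n + 1) + s)) $ (k * (n + 1) + j) =
        (if k = 0 \<and> j = s then - X_fun 0 s else 0) + (if k = l \<and> j = s then X_fun l s else 0)"
        using idx l s eq[OF s, of 0] eq[OF s, of l] by (simp add: generic_mat_def)
    qed
  qed auto
  also have "\<dots> = (\<Sum>s<n + 1. if s = j then
      (if k = 0 then - X_fun 0 j else 0) + (if k = l then X_fun l j else 0) else 0)"
    by (rule sum.cong) auto
  finally show ?thesis using l j by simp
qed

lemma del2_cols: "n \<ge> 1 \<Longrightarrow> (n - 1) * (n + 1) = n * (n - 1) + (n - (1::nat))"
  by (simp add: algebra_simps)

lemma diag_A_dims:
  "dim_row (diag_block_mat (map (A_block n) [0..<n])) = n * (n + 1)"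
  "dim_col (diag_block_mat (map (A_block n) [0..<n])) = n * (n - 1)"
  by (simp_all add: dim_diag_block_mat o_def A_block_def sum_list_triv)

lemma del2_carrier:
  assumes "n \<ge> 1"
  shows "del2 n \<in> carrier_mat (n * (n + 1)) ((n - 1) * (n + 1))"
  unfolding del2_cols[OF assms] by (rule carrier_matI) (simp_all add: del2_def diag_A_dims)

lemma del2_entry_A:
  assumes "k < n" "j < n + 1" "k' < n" "q < n - 1"
  shows "(del2 n :: 'a::field gpol mat) $$ (k * (n + 1) + j, k' * (n - 1) + q) =
    (if k = k' then mvar (insert_index k q, j) else 0)"
proof -
  have "k * (n + 1) + j < n * (n + 1)" "k' * (n - 1) + q < n * (n - 1)"
    using assms by (simp_all only: block_index_less)
  then have "(del2 n :: 'a gpol mat) $$ (k * (n + 1) + j, k' * (n - 1) + q) =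
      diag_block_mat (map (A_block n) [0..<n]) $$ (k * (n + 1) + j, k' * (n - 1) + q)"
    unfolding del2_def by (subst index_mat_four_block(1)) (simp_all add: diag_A_dims)
  also have "\<dots> = (if k = k' then map (A_block n) [0..<n] ! k $$ (j, q) else 0)"
    by (rule diag_block_mat_uniform) (use assms A_block_carrier in auto)
  finally show ?thesis using assms by (simp add: A_block_entry)
qed

lemma del2_entry_B:
  assumes "k < n" "j < n + 1" "q < n - 1"
  shows "(del2 n :: 'a::field gpol mat) $$ (k * (n + 1) + j, n * (n - 1) + q) =
    (if k = 0 then - X_fun 0 j else if k = q + 1 then X_fun k j else 0)"
proof -
  have idx: "k * (n + 1) + j < n * (n + 1)"
    using assms by (simp only: block_index_less)
  have "(del2 n :: 'a gpol mat) $$ (k * (n + 1) + j, n * (n - 1) + q) = B_col n (q + 1) $ (k * (n + 1) + j)"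
    unfolding del2_def by (subst index_mat_four_block(1))
      (use assms idx in \<open>simp_all add: diag_A_dims mat_of_cols_def\<close>)
  also have "\<dots> = (if k = 0 then - X_fun 0 j else if k = q + 1 then X_fun (q + 1) j else 0)"
    by (rule B_col_entry) (use assms in auto)
  finally show ?thesis by simp
qed

text \<open>The matrix \<open>M\<close> with \<^term>\<open>del2 n *\<^sub>v z\<close> equal to \<open>M X\<close>. The first \<open>n (n - 1)\<close> coordinates are the
  entries off the diagonal, row by row; the last \<open>n - 1\<close> coordinates are the diagonal entries other than
  the first, which is determined by the trace.\<close>

definition trace_free_matrix :: "nat \<Rightarrow> 'a::comm_ring_1 vec \<Rightarrow> nat \<Rightarrow> nat \<Rightarrow> 'a" where
  "trace_free_matrix n z k l =
    (if l \<noteq> k then z $ (k * (n - 1) + delete_index k l)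
     else if k = 0 then - (\<Sum>q<n - 1. z $ (n * (n - 1) + q))
     else z $ (n * (n - 1) + (k - 1)))"

lemma trace_free_matrix_trace:
  assumes "n \<ge> 1"
  shows "(\<Sum>k<n. trace_free_matrix n z k k) = 0"
proof -
  have "(\<Sum>k<n. trace_free_matrix n z k k) =
      trace_free_matrix n z 0 0 + (\<Sum>q<n - 1. trace_free_matrix n z (Suc q) (Suc q))"
    using assms sum_insert_index[of 0 n "\<lambda>k. trace_free_matrix n z k k"] by simp
  then show ?thesis by (simp add: trace_free_matrix_def)
qed

lemma del2_mult_vec:
  fixes z :: "'a::field gpol vec"
  assumes n: "n \<ge> 1" and z: "z \<in> carrier_vec ((n - 1) * (n + 1))" and k: "k < n" and j: "j < n + 1"
  shows "(del2 n *\<^sub>v z) $ (k * (n + 1) + j) = (\<Sum>l<n. trace_free_matrix n z k l * X_fun l j)"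
proof -
  have idx: "k * (n + 1) + j < n * (n + 1)" using block_index_less[OF k j] .
  have "(del2 n *\<^sub>v z) $ (k * (n + 1) + j) =
      (\<Sum>c<n * (n - 1) + (n - 1). del2 n $$ (k * (n + 1) + j, c) * z $ c)"
  proof -
    have "dim_row (del2 n :: 'a gpol mat) = n * (n + 1)" "dim_vec z = n * (n - 1) + (n - 1)"
      "dim_col (del2 n :: 'a gpol mat) = n * (n - 1) + (n - 1)"
      using del2_carrier[OF n, where 'a = 'a] z unfolding del2_cols[OF n] by auto
    then show ?thesis
      using idx by (simp add: scalar_prod_def atLeast0LessThan del: mult_Suc_right)
  qed
  also have "\<dots> = (\<Sum>k'<n. \<Sum>q<n - 1. del2 n $$ (k * (n + 1) + j, k' * (n - 1) + q) * z $ (k' * (n - 1) + q)) +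
      (\<Sum>q<n - 1. del2 n $$ (k * (n + 1) + j, n * (n - 1) + q) * z $ (n * (n - 1) + q))"
    unfolding sum_lessThan_add sum_blocks ..
  also have "(\<Sum>k'<n. \<Sum>q<n - 1. del2 n $$ (k * (n + 1) + j, k' * (n - 1) + q) * z $ (k' * (n - 1) + q)) =
      (\<Sum>k'<n. if k' = k then \<Sum>q<n - 1. mvar (insert_index k q, j) * z $ (k * (n - 1) + q) else 0)"
  proof (rule sum.cong[OF refl])
    fix k' assume "k' \<in> {..<n}"
    then have "del2 n $$ (k * (n + 1) + j, k' * (n - 1) + q) =
        (if k = k' then mvar (insert_index k q, j) else 0 :: 'a gpol)" if "q < n - 1" for q
      using that by (intro del2_entry_A k j) simp_all
    then show "(\<Sum>q<n - 1. del2 n $$ (k * (n + 1) + j, k' * (n - 1) + q) * z $ (k' * (n - 1) + q)) =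
        (if k' = k then \<Sum>q<n - 1. mvar (insert_index k q, j) * z $ (k * (n - 1) + q) else 0)"
      by simp
  qed
  also have "\<dots> = (\<Sum>q<n - 1. trace_free_matrix n z k (insert_index k q) * X_fun (insert_index k q) j)"
    using k by (simp add: trace_free_matrix_def mult.commute[of "mvar _"])
  also have "(\<Sum>q<n - 1. del2 n $$ (k * (n + 1) + j, n * (n - 1) + q) * z $ (n * (n - 1) + q)) =
      trace_free_matrix n z k k * X_fun k j"
  proof (cases "k = 0")
    case True
    have "(\<Sum>q<n - 1. del2 n $$ (k * (n + 1) + j, n * (n - 1) + q) * z $ (n * (n - 1) + q)) =
        (\<Sum>q<n - 1. - X_fun 0 j * z $ (n * (n - 1) + q))"
      using k j True del2_entry_B[of k n j, where 'a = 'a] by (intro sum.cong refl) auto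
    then show ?thesis
      using True by (simp add: trace_free_matrix_def sum_distrib_left sum_negf mult.commute)
  next
    case False
    have "(\<Sum>q<n - 1. del2 n $$ (k * (n + 1) + j, n * (n - 1) + q) * z $ (n * (n - 1) + q)) =
        (\<Sum>q<n - 1. if q = k - 1 then X_fun k j * z $ (n * (n - 1) + (k - 1)) else 0)"
      using k j False by (intro sum.cong refl) (subst del2_entry_B, auto)
    moreover have "k - 1 < n - 1" using False k by simp
    ultimately show ?thesis
      using False by (simp add: trace_free_matrix_def mult.commute)
  qed
  also have "(\<Sum>q<n - 1. trace_free_matrix n z k (insert_index k q) * X_fun (insert_index k q) j) +
      trace_free_matrix n z k k * X_fun k j = (\<Sum>l<n. trace_free_matrix n z k l * X_fun l j)"
    by (subst sum_insert_index[OF k]) simp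
  finally show ?thesis .
qed

lemma trace_free_matrix_eq_zero:
  assumes z: "z \<in> carrier_vec ((n - 1) * (n + 1))" and n: "n \<ge> 1"
    and zero: "\<And>k l. k < n \<Longrightarrow> l < n \<Longrightarrow> trace_free_matrix n z k l = 0"
  shows "z = 0\<^sub>v ((n - 1) * (n + 1))"
proof (rule eq_vecI)
  fix c assume "c < dim_vec (0\<^sub>v ((n - 1) * (n + 1)))"
  then have c: "c < n * (n - 1) + (n - 1)" using del2_cols[OF n] by simp
  have "z $ c = 0"
  proof (cases "c < n * (n - 1)")
    case True
    then obtain k q where kq: "k < n" "q < n - 1" and c: "c = k * (n - 1) + q"
      by (rule block_index_obtain)
    then have "insert_index k q < n" by (auto simp: insert_index_def)
    from zero[OF kq(1) this] show ?thesis
      unfolding c trace_free_matrix_def by simp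
  next
    case False
    then show ?thesis
      using zero[of "c - n * (n - 1) + 1" "c - n * (n - 1) + 1"] c by (simp add: trace_free_matrix_def)
  qed
  then show "z $ c = 0\<^sub>v ((n - 1) * (n + 1)) $ c" using \<open>c < dim_vec _\<close> by simp
qed (use z in simp)

lemma trace_free_matrix_surj:
  assumes n: "n \<ge> 1" and tr: "(\<Sum>k<n. M k k) = 0"
  shows "\<exists>z\<in>carrier_vec ((n - 1) * (n + 1)). (\<forall>c<(n - 1) * (n + 1). \<exists>k l. z $ c = M k l) \<and>
    (\<forall>k<n. \<forall>l<n. trace_free_matrix n z k l = M k l)"
proof -
  define z where "z = vec ((n - 1) * (n + 1)) (\<lambda>c.
    if c < n * (n - 1) then M (c div (n - 1)) (insert_index (c div (n - 1)) (c mod (n - 1)))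
    else M (c - n * (n - 1) + 1) (c - n * (n - 1) + 1))"
  have z_carrier: "z \<in> carrier_vec ((n - 1) * (n + 1))" by (simp add: z_def)
  have z_entries: "\<exists>k l. z $ c = M k l" if "c < (n - 1) * (n + 1)" for c
    using that by (auto simp: z_def)
  have z_B: "z $ (n * (n - 1) + q) = M (q + 1) (q + 1)" if "q < n - 1" for q
    using that unfolding z_def del2_cols[OF n] by simp
  have z_A: "z $ (k * (n - 1) + q) = M k (insert_index k q)" if "k < n" "q < n - 1" for k q
    using block_index_less[OF that] that unfolding z_def del2_cols[OF n] by simp
  have "trace_free_matrix n z k l = M k l" if "k < n" "l < n" for k l
  proof (cases "l = k")
    case False
    then have "delete_index k l < n - 1" "insert_index k (delete_index k l) = l"
      using that by (auto simp: delete_index_def insert_index_def)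
    then show ?thesis using False that z_A by (simp add: trace_free_matrix_def)
  next
    case True
    show ?thesis
    proof (cases "k = 0")
      case True
      have "(\<Sum>k<n. M k k) = M 0 0 + (\<Sum>q<n - 1. M (Suc q) (Suc q))"
        using n sum_insert_index[of 0 n "\<lambda>k. M k k"] by simp
      then show ?thesis
        using True \<open>l = k\<close> tr z_B by (simp add: trace_free_matrix_def minus_unique add.commute)
    next
      case False
      then show ?thesis using True that z_B[of "k - 1"] by (simp add: trace_free_matrix_def)
    qed
  qed
  then show ?thesis using z_carrier z_entries by blast
qed

section \<open>Free modules, quotient modules and gradings\<close>

lemma free_mod_simps [simp]:
  "zero (free_mod A m) = vec m (\<lambda>_. \<zero>\<^bsub>A\<^esub>)"
  "add (free_mod A m) = (\<lambda>v w. vec m (\<lambda>i. v $ i \<oplus>\<^bsub>A\<^esub> w $ i))"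
  "module.smult (free_mod A m) = (\<lambda>a v. vec m (\<lambda>i. a \<otimes>\<^bsub>A\<^esub> v $ i))"
  by (simp_all add: free_mod_def)

lemma free_mod_carrier_iff:
  "v \<in> carrier (free_mod A m) \<longleftrightarrow> dim_vec v = m \<and> (\<forall>i<m. v $ i \<in> carrier A)"
  unfolding free_mod_def carrier_vec_def partial_object.simps mem_Collect_eq by (rule refl)

lemma free_mod_module:
  assumes "cring A"
  shows "Module.module A (free_mod A m)"
proof -
  interpret A: cring A by fact
  have entry: "v $ i \<in> carrier A" if "v \<in> carrier (free_mod A m)" "i < m" for v i
    using that by (simp add: free_mod_carrier_iff)
  have eqI: "v = w" if "dim_vec v = m" "dim_vec w = m" "\<And>i. i < m \<Longrightarrow> v $ i = w $ i" for v w :: "'a vec"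
    using that by (intro eq_vecI) simp_all
  show ?thesis
  proof (rule moduleI)
    show "abelian_group (free_mod A m)"
    proof (rule abelian_groupI)
      fix x assume x: "x \<in> carrier (free_mod A m)"
      show "\<exists>y\<in>carrier (free_mod A m). y \<oplus>\<^bsub>free_mod A m\<^esub> x = \<zero>\<^bsub>free_mod A m\<^esub>"
        by (rule bexI[of _ "vec m (\<lambda>i. \<ominus>\<^bsub>A\<^esub> x $ i)"])
          (use x in \<open>auto simp: free_mod_carrier_iff A.l_neg intro!: eqI\<close>)
      show "\<zero>\<^bsub>free_mod A m\<^esub> \<oplus>\<^bsub>free_mod A m\<^esub> x = x"
        by (rule eqI) (use x in \<open>auto simp: free_mod_carrier_iff\<close>)
      fix y assume y: "y \<in> carrier (free_mod A m)"
      show "x \<oplus>\<^bsub>free_mod A m\<^esub> y \<in> carrier (free_mod A m)"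
        using x y by (simp add: free_mod_carrier_iff)
      show "x \<oplus>\<^bsub>free_mod A m\<^esub> y = y \<oplus>\<^bsub>free_mod A m\<^esub> x"
        by (rule eqI) (simp_all add: A.a_comm entry[OF x] entry[OF y])
      fix z assume z: "z \<in> carrier (free_mod A m)"
      show "x \<oplus>\<^bsub>free_mod A m\<^esub> y \<oplus>\<^bsub>free_mod A m\<^esub> z = x \<oplus>\<^bsub>free_mod A m\<^esub> (y \<oplus>\<^bsub>free_mod A m\<^esub> z)"
        by (rule eqI) (simp_all add: A.a_assoc entry[OF x] entry[OF y] entry[OF z])
    qed (simp add: free_mod_carrier_iff)
  next
    fix a x assume a: "a \<in> carrier A" and x: "x \<in> carrier (free_mod A m)"
    show "a \<odot>\<^bsub>free_mod A m\<^esub> x \<in> carrier (free_mod A m)"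
      using a x by (simp add: free_mod_carrier_iff)
    fix b assume b: "b \<in> carrier A"
    show "(a \<oplus>\<^bsub>A\<^esub> b) \<odot>\<^bsub>free_mod A m\<^esub> x = a \<odot>\<^bsub>free_mod A m\<^esub> x \<oplus>\<^bsub>free_mod A m\<^esub> b \<odot>\<^bsub>free_mod A m\<^esub> x"
      by (rule eqI) (simp_all add: A.l_distr a b entry[OF x])
    show "(a \<otimes>\<^bsub>A\<^esub> b) \<odot>\<^bsub>free_mod A m\<^esub> x = a \<odot>\<^bsub>free_mod A m\<^esub> (b \<odot>\<^bsub>free_mod A m\<^esub> x)"
      by (rule eqI) (simp_all add: A.m_assoc a b entry[OF x])
  next
    fix a x y assume a: "a \<in> carrier A" and x: "x \<in> carrier (free_mod A m)" and y: "y \<in> carrier (free_mod A m)"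
    show "a \<odot>\<^bsub>free_mod A m\<^esub> (x \<oplus>\<^bsub>free_mod A m\<^esub> y) = a \<odot>\<^bsub>free_mod A m\<^esub> x \<oplus>\<^bsub>free_mod A m\<^esub> a \<odot>\<^bsub>free_mod A m\<^esub> y"
      by (rule eqI) (simp_all add: A.r_distr a entry[OF x] entry[OF y])
  next
    fix x assume x: "x \<in> carrier (free_mod A m)"
    show "\<one>\<^bsub>A\<^esub> \<odot>\<^bsub>free_mod A m\<^esub> x = x"
      by (rule eqI) (use x in \<open>auto simp: free_mod_carrier_iff\<close>)
  qed (rule A.is_cring)
qed

lemma quot_mod_simps:
  "carrier (quot_mod M N) = a_rcosets\<^bsub>M\<^esub> N"
  "zero (quot_mod M N) = N"
  "add (quot_mod M N) = set_add M"
  "module.smult (quot_mod M N) = (\<lambda>a C. \<Union>x\<in>C. N +>\<^bsub>M\<^esub> (a \<odot>\<^bsub>M\<^esub> x))"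
  by (simp_all add: quot_mod_def)

context
  fixes A :: "'a ring" and M :: "('a, 'b) module" and N :: "'b set"
  assumes M: "Module.module A M" and N: "Module.submodule N A M"
begin

interpretation M: Module.module A M by (rule M)
interpretation N: Module.submodule N A M by (rule N)
interpretation N: abelian_subgroup N M
  by (intro abelian_subgroupI3 additive_subgroup.intro N.is_subgroup M.abelian_group_axioms)

lemma quot_mod_carrier: "carrier (quot_mod M N) = (\<lambda>x. N +>\<^bsub>M\<^esub> x) ` carrier M"
  by (auto simp: quot_mod_simps A_RCOSETS_def')

lemma quot_mod_zero: "x \<in> N \<Longrightarrow> N +>\<^bsub>M\<^esub> x = N"
  by (rule M.a_coset_join2[OF N.a_Hcarr N.a_subgroup])

lemma quot_mod_eq_zero_iff: "x \<in> carrier M \<Longrightarrow> N +>\<^bsub>M\<^esub> x = N \<longleftrightarrow> x \<in> N"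
  using quot_mod_zero[of x] N.a_rcos_self[of x] by auto

lemma quot_mod_add:
  "x \<in> carrier M \<Longrightarrow> y \<in> carrier M \<Longrightarrow>
    (N +>\<^bsub>M\<^esub> x) \<oplus>\<^bsub>quot_mod M N\<^esub> (N +>\<^bsub>M\<^esub> y) = N +>\<^bsub>M\<^esub> (x \<oplus>\<^bsub>M\<^esub> y)"
  by (simp add: quot_mod_simps N.a_rcos_sum)

lemma quot_mod_smult:
  assumes a: "a \<in> carrier A" and x: "x \<in> carrier M"
  shows "a \<odot>\<^bsub>quot_mod M N\<^esub> (N +>\<^bsub>M\<^esub> x) = N +>\<^bsub>M\<^esub> (a \<odot>\<^bsub>M\<^esub> x)"
proof -
  have *: "N +>\<^bsub>M\<^esub> (a \<odot>\<^bsub>M\<^esub> y) = N +>\<^bsub>M\<^esub> (a \<odot>\<^bsub>M\<^esub> x)" if y: "y \<in> N +>\<^bsub>M\<^esub> x" for y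
  proof -
    obtain h where h: "h \<in> N" "y = h \<oplus>\<^bsub>M\<^esub> x"
      using y by (auto simp: a_r_coset_def')
    then have "a \<odot>\<^bsub>M\<^esub> y = a \<odot>\<^bsub>M\<^esub> h \<oplus>\<^bsub>M\<^esub> a \<odot>\<^bsub>M\<^esub> x"
      using a x N.a_Hcarr by (simp add: M.smult_r_distr)
    then have "a \<odot>\<^bsub>M\<^esub> y \<in> N +>\<^bsub>M\<^esub> (a \<odot>\<^bsub>M\<^esub> x)"
      using N.smult_closed[OF a h(1)] by (auto simp: a_r_coset_def')
    then show ?thesis
      using N.a_repr_independence'[OF _ M.smult_closed[OF a x]] by simp
  qed
  have "(\<Union>y\<in>N +>\<^bsub>M\<^esub> x. N +>\<^bsub>M\<^esub> (a \<odot>\<^bsub>M\<^esub> y)) = (\<Union>y\<in>N +>\<^bsub>M\<^esub> x. N +>\<^bsub>M\<^esub> (a \<odot>\<^bsub>M\<^esub> x))"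
    by (rule SUP_cong[OF refl *])
  moreover have "x \<in> N +>\<^bsub>M\<^esub> x" using x by (rule N.a_rcos_self)
  ultimately show ?thesis by (auto simp: quot_mod_simps)
qed

text \<open>The laws are inherited from \<open>M\<close> through representatives of the cosets.\<close>

lemma quot_mod_module: "Module.module A (quot_mod M N)"
proof -
  have zero: "\<zero>\<^bsub>quot_mod M N\<^esub> = N +>\<^bsub>M\<^esub> \<zero>\<^bsub>M\<^esub>"
    using quot_mod_zero[OF N.zero_closed] by (simp add: quot_mod_simps)
  have ab: "abelian_group (quot_mod M N)"
  proof (rule abelian_groupI)
    fix C assume "C \<in> carrier (quot_mod M N)"
    then obtain x where x: "x \<in> carrier M" "C = N +>\<^bsub>M\<^esub> x" by (auto simp: quot_mod_carrier)
    then have "(N +>\<^bsub>M\<^esub> (\<ominus>\<^bsub>M\<^esub> x)) \<oplus>\<^bsub>quot_mod M N\<^esub> C = \<zero>\<^bsub>quot_mod M N\<^esub>"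
      unfolding zero by (simp only: quot_mod_add M.a_inv_closed M.l_neg)
    then show "\<exists>D\<in>carrier (quot_mod M N). D \<oplus>\<^bsub>quot_mod M N\<^esub> C = \<zero>\<^bsub>quot_mod M N\<^esub>"
      using x by (intro bexI[of _ "N +>\<^bsub>M\<^esub> (\<ominus>\<^bsub>M\<^esub> x)"]) (auto simp: quot_mod_carrier)
    show "\<zero>\<^bsub>quot_mod M N\<^esub> \<oplus>\<^bsub>quot_mod M N\<^esub> C = C"
      unfolding zero x(2) using x(1) by (simp only: quot_mod_add M.zero_closed M.l_zero)
    fix D assume "D \<in> carrier (quot_mod M N)"
    then obtain y where y: "y \<in> carrier M" "D = N +>\<^bsub>M\<^esub> y" by (auto simp: quot_mod_carrier)
    show "C \<oplus>\<^bsub>quot_mod M N\<^esub> D = D \<oplus>\<^bsub>quot_mod M N\<^esub> C"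
      unfolding x(2) y(2) quot_mod_add[OF x(1) y(1)] quot_mod_add[OF y(1) x(1)]
      using x(1) y(1) by (simp only: M.a_comm)
    show "C \<oplus>\<^bsub>quot_mod M N\<^esub> D \<in> carrier (quot_mod M N)"
      unfolding x(2) y(2) quot_mod_add[OF x(1) y(1)] quot_mod_carrier
      using x(1) y(1) by (intro imageI M.a_closed)
    fix E assume "E \<in> carrier (quot_mod M N)"
    then obtain z where z: "z \<in> carrier M" "E = N +>\<^bsub>M\<^esub> z" by (auto simp: quot_mod_carrier)
    show "C \<oplus>\<^bsub>quot_mod M N\<^esub> D \<oplus>\<^bsub>quot_mod M N\<^esub> E = C \<oplus>\<^bsub>quot_mod M N\<^esub> (D \<oplus>\<^bsub>quot_mod M N\<^esub> E)"
      unfolding x(2) y(2) z(2) using x(1) y(1) z(1) by (simp only: quot_mod_add M.a_closed M.a_assoc)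
  qed (use zero in \<open>auto simp: quot_mod_carrier\<close>)
  show ?thesis
  proof (rule moduleI)
    show "abelian_group (quot_mod M N)" by (rule ab)
    show "cring A" by (rule M.is_cring)
    fix C assume "C \<in> carrier (quot_mod M N)"
    then obtain x where x: "x \<in> carrier M" "C = N +>\<^bsub>M\<^esub> x" by (auto simp: quot_mod_carrier)
    show "\<one>\<^bsub>A\<^esub> \<odot>\<^bsub>quot_mod M N\<^esub> C = C"
      unfolding x(2) using x(1) by (simp only: quot_mod_smult M.R.one_closed M.smult_one)
    fix a assume a: "a \<in> carrier A"
    show "a \<odot>\<^bsub>quot_mod M N\<^esub> C \<in> carrier (quot_mod M N)"
      unfolding x(2) quot_mod_smult[OF a x(1)] quot_mod_carrier using a x(1) by (intro imageI M.smult_closed)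
    fix b assume b: "b \<in> carrier A"
    show "(a \<oplus>\<^bsub>A\<^esub> b) \<odot>\<^bsub>quot_mod M N\<^esub> C = a \<odot>\<^bsub>quot_mod M N\<^esub> C \<oplus>\<^bsub>quot_mod M N\<^esub> b \<odot>\<^bsub>quot_mod M N\<^esub> C"
      unfolding x(2) using a b x(1)
      by (simp only: quot_mod_smult quot_mod_add M.smult_closed M.R.a_closed M.smult_l_distr)
    show "(a \<otimes>\<^bsub>A\<^esub> b) \<odot>\<^bsub>quot_mod M N\<^esub> C = a \<odot>\<^bsub>quot_mod M N\<^esub> (b \<odot>\<^bsub>quot_mod M N\<^esub> C)"
      unfolding x(2) using a b x(1)
      by (simp only: quot_mod_smult M.smult_closed M.R.m_closed M.smult_assoc1)
  next
    fix a C D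
    assume a: "a \<in> carrier A" and "C \<in> carrier (quot_mod M N)" "D \<in> carrier (quot_mod M N)"
    then obtain x y where xy: "x \<in> carrier M" "C = N +>\<^bsub>M\<^esub> x" "y \<in> carrier M" "D = N +>\<^bsub>M\<^esub> y"
      by (auto simp: quot_mod_carrier)
    show "a \<odot>\<^bsub>quot_mod M N\<^esub> (C \<oplus>\<^bsub>quot_mod M N\<^esub> D) =
        a \<odot>\<^bsub>quot_mod M N\<^esub> C \<oplus>\<^bsub>quot_mod M N\<^esub> a \<odot>\<^bsub>quot_mod M N\<^esub> D"
      unfolding xy(2,4) using a xy(1,3)
      by (simp only: quot_mod_smult quot_mod_add M.smult_closed M.a_closed M.smult_r_distr)
  qed
qed

end

lemma restrict_scalars_simps [simp]:
  "carrier (restrict_scalars \<phi> M) = carrier M"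
  "zero (restrict_scalars \<phi> M) = zero M"
  "add (restrict_scalars \<phi> M) = add M"
  "module.smult (restrict_scalars \<phi> M) = (\<lambda>q x. \<phi> q \<odot>\<^bsub>M\<^esub> x)"
  by (simp_all add: restrict_scalars_def)

lemma restrict_scalars_module:
  assumes Q: "cring Q" and M: "Module.module A M" and \<phi>: "\<phi> \<in> Ring.ring_hom Q A"
  shows "Module.module Q (restrict_scalars \<phi> M)"
proof -
  interpret M: Module.module A M by fact
  interpret Q: cring Q by fact
  have closed: "\<phi> q \<in> carrier A" if "q \<in> carrier Q" for q
    using \<phi> that by (rule ring_hom_closed)
  show ?thesis
  proof (intro moduleI abelian_groupI Q)
    fix x assume "x \<in> carrier (restrict_scalars \<phi> M)"
    then show "\<exists>y\<in>carrier (restrict_scalars \<phi> M). y \<oplus>\<^bsub>restrict_scalars \<phi> M\<^esub> x = \<zero>\<^bsub>restrict_scalars \<phi> M\<^esub>"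
      by (intro bexI[of _ "\<ominus>\<^bsub>M\<^esub> x"]) (auto simp: M.l_neg)
  qed (auto simp: closed M.a_ac M.smult_l_distr M.smult_r_distr M.smult_assoc1
      ring_hom_add[OF \<phi>] ring_hom_mult[OF \<phi>] ring_hom_one[OF \<phi>])
qed

lemma map_vec_free_mod:
  assumes h: "h \<in> Ring.ring_hom A B"
  shows "v \<in> carrier (free_mod A m) \<Longrightarrow> map_vec h v \<in> carrier (free_mod B m)"
    and "v \<in> carrier (free_mod A m) \<Longrightarrow> w \<in> carrier (free_mod A m) \<Longrightarrow>
      map_vec h (v \<oplus>\<^bsub>free_mod A m\<^esub> w) = map_vec h v \<oplus>\<^bsub>free_mod B m\<^esub> map_vec h w"
    and "a \<in> carrier A \<Longrightarrow> v \<in> carrier (free_mod A m) \<Longrightarrow>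
      map_vec h (a \<odot>\<^bsub>free_mod A m\<^esub> v) = h a \<odot>\<^bsub>free_mod B m\<^esub> map_vec h v"
  by (auto simp: free_mod_carrier_iff ring_hom_closed[OF h] ring_hom_add[OF h] ring_hom_mult[OF h]
      intro!: eq_vecI)

lemma map_vec_free_mod_surj:
  assumes surj: "carrier B = h ` carrier A"
  shows "map_vec h ` carrier (free_mod A m) \<supseteq> carrier (free_mod B m)"
proof
  fix v assume v: "v \<in> carrier (free_mod B m)"
  then have "\<forall>i. \<exists>p. i < m \<longrightarrow> p \<in> carrier A \<and> v $ i = h p"
    using surj by (auto simp: free_mod_carrier_iff)
  then obtain p where "\<forall>i. i < m \<longrightarrow> p i \<in> carrier A \<and> v $ i = h (p i)"
    unfolding choice_iff by blast
  then show "v \<in> map_vec h ` carrier (free_mod A m)"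
    using v by (intro image_eqI[of _ _ "vec m p"]) (auto simp: free_mod_carrier_iff intro!: eq_vecI)
qed

lemma mat_map_hom:
  assumes A: "cring A" and B: "cring B" and h: "h \<in> Ring.ring_hom A B"
    and D: "\<And>i j. i < dim_row D \<Longrightarrow> j < dim_col D \<Longrightarrow> D $$ (i, j) \<in> carrier A"
    and v: "v \<in> carrier (free_mod A (dim_col D))"
  shows "mat_map B (map_mat h D) (map_vec h v) = map_vec h (mat_map A D v)"
proof -
  interpret h: ring_hom_cring A B h
    using A B h by (intro ring_hom_cring.intro ring_hom_cring_axioms.intro) auto
  show ?thesis
  proof (rule eq_vecI)
    fix i assume "i < dim_vec (map_vec h (mat_map A D v))"
    then have i: "i < dim_row D" by (simp add: mat_map_def)
    have "(\<Oplus>\<^bsub>B\<^esub>j\<in>{..<dim_col D}. h (D $$ (i, j)) \<otimes>\<^bsub>B\<^esub> h (v $ j)) =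
        h (\<Oplus>\<^bsub>A\<^esub>j\<in>{..<dim_col D}. D $$ (i, j) \<otimes>\<^bsub>A\<^esub> v $ j)"
      using v i D by (subst h.hom_finsum)
        (auto simp: free_mod_carrier_iff intro!: h.S.finsum_cong' h.hom_closed)
    moreover have "(\<Oplus>\<^bsub>B\<^esub>j\<in>{..<dim_col D}. map_mat h D $$ (i, j) \<otimes>\<^bsub>B\<^esub> map_vec h v $ j) =
        (\<Oplus>\<^bsub>B\<^esub>j\<in>{..<dim_col D}. h (D $$ (i, j)) \<otimes>\<^bsub>B\<^esub> h (v $ j))"
      using v i D by (intro h.S.finsum_cong') (auto simp: free_mod_carrier_iff intro!: h.hom_closed)
    ultimately show "mat_map B (map_mat h D) (map_vec h v) $ i = map_vec h (mat_map A D v) $ i"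
      using i by (simp add: mat_map_def)
  qed (simp add: mat_map_def)
qed

lemma finsum_mpol_ring:
  fixes f :: "'x \<Rightarrow> ('v, 'a::comm_ring_1) mpol"
  assumes "finite S" "\<And>x. x \<in> S \<Longrightarrow> f x \<in> carrier (mpol_ring V)"
  shows "finsum (mpol_ring V) f S = sum f S"
proof -
  interpret cring "mpol_ring V :: ('v, 'a) mpol ring" by (rule cring_mpol_ring)
  show ?thesis using assms by (induction S rule: finite_induct) auto
qed

lemma mat_map_mpol_ring:
  assumes D: "\<And>i j. i < dim_row D \<Longrightarrow> j < dim_col D \<Longrightarrow> D $$ (i, j) \<in> carrier (mpol_ring V)"
    and v: "v \<in> carrier (free_mod (mpol_ring V) (dim_col D))"
  shows "mat_map (mpol_ring V) D v = D *\<^sub>v v"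
proof (rule eq_vecI)
  fix i assume "i < dim_vec (D *\<^sub>v v)"
  then show "mat_map (mpol_ring V) D v $ i = (D *\<^sub>v v) $ i"
    using D v by (simp add: mat_map_def scalar_prod_def free_mod_carrier_iff atLeast0LessThan)
      (subst finsum_mpol_ring, auto)
qed (simp add: mat_map_def)

text \<open>The component of degree \<open>d\<close> for basis vectors of degree \<open>0\<close>.\<close>

definition vec_part :: "int \<Rightarrow> ('v, 'a::comm_ring_1) mpol vec \<Rightarrow> ('v, 'a) mpol vec" where
  "vec_part d = map_vec (mon_part {m. int (monom_degree m) = d})"

lemma mon_part_homog_comp:
  "p \<in> homog_comp V e \<Longrightarrow>
    mon_part {m. int (monom_degree m) = d} p = (if d = e then p else 0)"
  by (auto simp: homog_comp_def intro: mon_part_id mon_part_eq_zero)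

lemma mon_part_in_homog_comp:
  "p \<in> carrier (mpol_ring V) \<Longrightarrow> mon_part {m. int (monom_degree m) = d} p \<in> homog_comp V d"
  by (auto simp: homog_comp_def mpol_carrier_iff keys_mon_part)

lemma mon_part_homog_mult:
  assumes "a \<in> homog_comp V c"
  shows "mon_part {m. int (monom_degree m) = d} (a * p) =
    a * mon_part {m. int (monom_degree m) = d - c} p"
  by (rule mon_part_mult) (use assms in \<open>auto simp: homog_comp_def monom_degree_add\<close>)

lemma sum_mon_part:
  assumes "finite D" "\<And>m. m \<in> keys p \<Longrightarrow> int (monom_degree m) \<in> D"
  shows "(\<Sum>d\<in>D. mon_part {m. int (monom_degree m) = d} p) = p"
proof (rule poly_mapping_eqI)
  fix m
  have "lookup (\<Sum>d\<in>D. mon_part {m. int (monom_degree m) = d} p) m =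
      (\<Sum>d\<in>D. if int (monom_degree m) = d then lookup p m else 0)"
    by (simp add: lookup_sum lookup_mon_part)
  then show "lookup (\<Sum>d\<in>D. mon_part {m. int (monom_degree m) = d} p) m = lookup p m"
    using assms by (auto simp: in_keys_iff)
qed

lemma graded_free_comp_replicate:
  "v \<in> graded_free_comp V (replicate m c) d \<longleftrightarrow>
    dim_vec v = m \<and> (\<forall>i<m. v $ i \<in> homog_comp V (d - c))"
  by (auto simp: graded_free_comp_def free_mod_carrier_iff homog_comp_carrier)

text \<open>A graded free module induces a grading on a homomorphic image \<open>M\<close> as soon as the kernel contains the
  homogeneous components of its elements. Existence of decompositions is clear by lifting. For
  uniqueness, lift a second decomposition componentwise; the difference of the two lifts lies in the
  kernel, hence so do its components.\<close>

lemma graded_module_image: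
  fixes M :: "(('v, 'a::comm_ring_1) mpol, 'm) module"
  assumes M: "Module.module (mpol_ring V) M"
    and hom: "\<epsilon> \<in> LinearCombinations.module_hom (mpol_ring V) (free_mod (mpol_ring V) m) M"
    and surj: "\<epsilon> ` carrier (free_mod (mpol_ring V) m) = carrier M"
    and homog: "\<And>v d. v \<in> carrier (free_mod (mpol_ring V) m) \<Longrightarrow> \<epsilon> v = \<zero>\<^bsub>M\<^esub> \<Longrightarrow> \<epsilon> (vec_part d v) = \<zero>\<^bsub>M\<^esub>"
  shows "graded_module V M (\<lambda>d. \<epsilon> ` graded_free_comp V (replicate m 0) d)"
proof -
  interpret M: Module.module "mpol_ring V" M by (rule M)
  let ?F = "free_mod (mpol_ring V) m"
  let ?G = "graded_free_comp V (replicate m 0) :: int \<Rightarrow> ('v, 'a) mpol vec set"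
  have closed: "\<epsilon> v \<in> carrier M" if "v \<in> carrier ?F" for v
    using LinearCombinations.module_hom_closed[OF hom] that by blast
  have F_add: "v + w \<in> carrier ?F" if "v \<in> carrier ?F" "w \<in> carrier ?F" for v w
    using that by (auto simp: free_mod_carrier_iff)
  have F_minus: "v - w \<in> carrier ?F" if "v \<in> carrier ?F" "w \<in> carrier ?F" for v w
    using that by (auto simp: free_mod_carrier_iff)
  have F_zero: "0\<^sub>v m \<in> carrier ?F" by (simp add: free_mod_carrier_iff)
  have G_F: "v \<in> carrier ?F" if "v \<in> ?G d" for v d
    using that by (auto simp: graded_free_comp_replicate free_mod_carrier_iff homog_comp_carrier)
  have part_G: "vec_part d v \<in> ?G d" if "v \<in> carrier ?F" for v d
    using that by (auto simp: graded_free_comp_replicate free_mod_carrier_iff vec_part_def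
        intro: mon_part_in_homog_comp)
  have add: "\<epsilon> (v + w) = \<epsilon> v \<oplus>\<^bsub>M\<^esub> \<epsilon> w" if "v \<in> carrier ?F" "w \<in> carrier ?F" for v w
  proof -
    have "v + w = v \<oplus>\<^bsub>?F\<^esub> w" using that by (auto simp: free_mod_carrier_iff)
    then show ?thesis using LinearCombinations.module_hom_add[OF hom that] by simp
  qed
  have zero: "\<epsilon> (0\<^sub>v m) = \<zero>\<^bsub>M\<^esub>"
    using add[OF F_zero F_zero] closed[OF F_zero] by (simp add: M.add.l_cancel_one')
  have diff: "\<epsilon> (v - w) = \<zero>\<^bsub>M\<^esub> \<longleftrightarrow> \<epsilon> v = \<epsilon> w" if "v \<in> carrier ?F" "w \<in> carrier ?F" for v w
  proof -
    have "v = (v - w) + w" using that by (auto simp: free_mod_carrier_iff)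
    then have "\<epsilon> v = \<epsilon> (v - w) \<oplus>\<^bsub>M\<^esub> \<epsilon> w" using add[OF F_minus[OF that] that(2)] by simp
    then show ?thesis
      using closed that F_minus[OF that] by (simp add: M.add.r_cancel_one)
  qed
  have sum: "\<epsilon> (vec m (\<lambda>i. \<Sum>d\<in>D. w d $ i)) = (\<Oplus>\<^bsub>M\<^esub>d\<in>D. \<epsilon> (w d))"
    and sum_closed: "vec m (\<lambda>i. \<Sum>d\<in>D. w d $ i) \<in> carrier ?F"
    if "finite D" "\<And>d. d \<in> D \<Longrightarrow> w d \<in> carrier ?F" for D :: "int set" and w
  proof -
    show cl: "vec m (\<lambda>i. \<Sum>d\<in>D. w d $ i) \<in> carrier ?F"
      using that by (auto simp: free_mod_carrier_iff)
    show "\<epsilon> (vec m (\<lambda>i. \<Sum>d\<in>D. w d $ i)) = (\<Oplus>\<^bsub>M\<^esub>d\<in>D. \<epsilon> (w d))"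
      using that
    proof (induction D rule: finite_induct)
      case empty
      have "vec m (\<lambda>i. 0) = (0\<^sub>v m :: ('v, 'a) mpol vec)" by (auto intro: eq_vecI)
      then show ?case using zero by simp
    next
      case (insert d D)
      have "vec m (\<lambda>i. \<Sum>d\<in>insert d D. w d $ i) = w d + vec m (\<lambda>i. \<Sum>d\<in>D. w d $ i)"
        using insert by (auto simp: free_mod_carrier_iff intro!: eq_vecI)
      moreover have "vec m (\<lambda>i. \<Sum>d\<in>D. w d $ i) \<in> carrier ?F"
        using insert by (auto simp: free_mod_carrier_iff)
      ultimately show ?case
        using insert closed by (simp add: add)
    qed
  qed
  have sub: "subgroup (\<epsilon> ` ?G d) (add_monoid M)" for d
  proof (rule subgroup.intro)
    show "\<epsilon> ` ?G d \<subseteq> carrier (add_monoid M)" using closed G_F by auto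
    show "x \<otimes>\<^bsub>add_monoid M\<^esub> y \<in> \<epsilon> ` ?G d" if xy: "x \<in> \<epsilon> ` ?G d" "y \<in> \<epsilon> ` ?G d" for x y
    proof -
      obtain v w where "v \<in> ?G d" "x = \<epsilon> v" "w \<in> ?G d" "y = \<epsilon> w" using xy by blast
      moreover from this have "v + w \<in> ?G d"
        by (auto simp: graded_free_comp_replicate intro: homog_comp_add)
      ultimately show ?thesis using add G_F by (metis image_eqI monoid.simps(1))
    qed
    have "0\<^sub>v m \<in> ?G d" by (simp add: graded_free_comp_replicate)
    then show "\<one>\<^bsub>add_monoid M\<^esub> \<in> \<epsilon> ` ?G d" using zero by (metis image_eqI monoid.simps(2))
    show "inv\<^bsub>add_monoid M\<^esub> x \<in> \<epsilon> ` ?G d" if x: "x \<in> \<epsilon> ` ?G d" for x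
    proof -
      obtain v where v: "v \<in> ?G d" "x = \<epsilon> v" using x by blast
      then have mv: "- v \<in> ?G d"
        by (auto simp: graded_free_comp_replicate intro: homog_comp_uminus)
      have "- v + v = 0\<^sub>v m" using v by (auto simp: graded_free_comp_replicate)
      then have "\<epsilon> (- v) \<oplus>\<^bsub>M\<^esub> \<epsilon> v = \<zero>\<^bsub>M\<^esub>"
        using add[OF G_F[OF mv] G_F[OF v(1)]] zero by simp
      then have "\<ominus>\<^bsub>M\<^esub> x = \<epsilon> (- v)"
        using closed G_F mv v M.minus_equality by auto
      then show ?thesis using mv by (simp add: a_inv_def)
    qed
  qed
  have smult: "p \<odot>\<^bsub>M\<^esub> x \<in> \<epsilon> ` ?G (c + d)" if p: "p \<in> homog_comp V c" and x: "x \<in> \<epsilon> ` ?G d" for c d p x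
  proof -
    obtain v where v: "v \<in> ?G d" "x = \<epsilon> v" using x by blast
    have "\<epsilon> (p \<odot>\<^bsub>?F\<^esub> v) = p \<odot>\<^bsub>M\<^esub> x"
      using LinearCombinations.module_hom_smult[OF hom homog_comp_carrier[OF p] G_F[OF v(1)]] v by simp
    moreover have "p \<odot>\<^bsub>?F\<^esub> v \<in> ?G (c + d)"
      using v homog_comp_mult[OF p] by (auto simp: graded_free_comp_replicate)
    ultimately show ?thesis by (metis image_eqI)
  qed
  have decomp: "\<exists>!f. (\<forall>d. f d \<in> \<epsilon> ` ?G d) \<and> finite {d. f d \<noteq> \<zero>\<^bsub>M\<^esub>} \<and>
      x = (\<Oplus>\<^bsub>M\<^esub>d\<in>{d. f d \<noteq> \<zero>\<^bsub>M\<^esub>}. f d)" if x: "x \<in> carrier M" for x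
  proof -
    obtain v where v: "v \<in> carrier ?F" "x = \<epsilon> v" using x surj by blast
    define f where "f d = \<epsilon> (vec_part d v)" for d
    define D where "D = (\<Union>i<m. (\<lambda>a. int (monom_degree a)) ` keys (v $ i))"
    have D: "finite D" by (simp add: D_def)
    have D_mem: "int (monom_degree a) \<in> D" if "i < m" "a \<in> keys (v $ i)" for i a
      unfolding D_def using that by blast
    have f_closed: "f d \<in> carrier M" for d
      unfolding f_def by (intro closed G_F[OF part_G] v)
    have support: "{d. f d \<noteq> \<zero>\<^bsub>M\<^esub>} \<subseteq> D"
    proof
      fix d assume d: "d \<in> {d. f d \<noteq> \<zero>\<^bsub>M\<^esub>}"
      show "d \<in> D"
      proof (rule ccontr)
        assume "d \<notin> D"
        then have "mon_part {m. int (monom_degree m) = d} (v $ i) = 0" if "i < m" for i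
          by (intro mon_part_eq_zero) (use that D_mem in auto)
        then have "vec_part d v = 0\<^sub>v m"
          using v(1) by (auto simp: vec_part_def free_mod_carrier_iff intro!: eq_vecI)
        then show False using d zero by (simp add: f_def)
      qed
    qed
    have "vec m (\<lambda>i. \<Sum>d\<in>D. vec_part d v $ i) = v"
    proof (rule eq_vecI)
      fix i assume "i < dim_vec v"
      then have "i < m" using v(1) by (simp add: free_mod_carrier_iff)
      then show "vec m (\<lambda>i. \<Sum>d\<in>D. vec_part d v $ i) $ i = v $ i"
        using sum_mon_part[OF D D_mem] v(1) by (simp add: vec_part_def free_mod_carrier_iff)
    qed (use v(1) in \<open>simp add: free_mod_carrier_iff\<close>)
    then have "x = (\<Oplus>\<^bsub>M\<^esub>d\<in>D. f d)"
      using sum[OF D, of "\<lambda>d. vec_part d v", OF G_F[OF part_G[OF v(1)]]] v by (simp add: f_def)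
    also have "\<dots> = (\<Oplus>\<^bsub>M\<^esub>d\<in>{d. f d \<noteq> \<zero>\<^bsub>M\<^esub>}. f d)"
      by (rule M.add.finprod_mono_neutral_cong_right) (use D support f_closed in auto)
    finally have f_sum: "x = (\<Oplus>\<^bsub>M\<^esub>d\<in>{d. f d \<noteq> \<zero>\<^bsub>M\<^esub>}. f d)" .
    show ?thesis
    proof (rule ex1I[of _ f])
      show "(\<forall>d. f d \<in> \<epsilon> ` ?G d) \<and> finite {d. f d \<noteq> \<zero>\<^bsub>M\<^esub>} \<and>
          x = (\<Oplus>\<^bsub>M\<^esub>d\<in>{d. f d \<noteq> \<zero>\<^bsub>M\<^esub>}. f d)"
        using f_sum finite_subset[OF support D] part_G v(1) by (auto simp: f_def)
    next
      fix g assume g: "(\<forall>d. g d \<in> \<epsilon> ` ?G d) \<and> finite {d. g d \<noteq> \<zero>\<^bsub>M\<^esub>} \<and>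
          x = (\<Oplus>\<^bsub>M\<^esub>d\<in>{d. g d \<noteq> \<zero>\<^bsub>M\<^esub>}. g d)"
      let ?S = "{d. g d \<noteq> \<zero>\<^bsub>M\<^esub>}"
      have "\<forall>d. \<exists>w. w \<in> ?G d \<and> g d = \<epsilon> w \<and> (g d = \<zero>\<^bsub>M\<^esub> \<longrightarrow> w = 0\<^sub>v m)"
      proof
        fix d
        show "\<exists>w. w \<in> ?G d \<and> g d = \<epsilon> w \<and> (g d = \<zero>\<^bsub>M\<^esub> \<longrightarrow> w = 0\<^sub>v m)"
        proof (cases "g d = \<zero>\<^bsub>M\<^esub>")
          case True
          then show ?thesis using zero by (intro exI[of _ "0\<^sub>v m"]) (simp add: graded_free_comp_replicate)
        next
          case False
          then show ?thesis using g by blast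
        qed
      qed
      \<comment> \<open>The lift of a zero component is chosen to be zero, so that the sum of the lifts is finite and its
        component of degree \<open>d\<close> is \<open>w d\<close> for every \<open>d\<close>.\<close>
      then obtain w where "\<forall>d. w d \<in> ?G d \<and> g d = \<epsilon> (w d) \<and> (g d = \<zero>\<^bsub>M\<^esub> \<longrightarrow> w d = 0\<^sub>v m)"
        unfolding choice_iff by blast
      then have w: "\<And>d. w d \<in> ?G d" "\<And>d. g d = \<epsilon> (w d)" "\<And>d. g d = \<zero>\<^bsub>M\<^esub> \<Longrightarrow> w d = 0\<^sub>v m"
        by blast+
      define u where "u = vec m (\<lambda>i. \<Sum>d\<in>?S. w d $ i)"
      have fin: "finite ?S" using g by blast
      have u: "u \<in> carrier ?F" unfolding u_def by (rule sum_closed[OF fin]) (rule G_F[OF w(1)])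
      have "\<epsilon> u = (\<Oplus>\<^bsub>M\<^esub>d\<in>?S. g d)"
        unfolding u_def w(2)[symmetric] by (subst sum[OF fin G_F[OF w(1)]]) (simp only: w(2)[symmetric])
      then have "\<epsilon> (u - v) = \<zero>\<^bsub>M\<^esub>" using diff[OF u v(1)] g v(2) by simp
      then have hom0: "\<epsilon> (vec_part d (u - v)) = \<zero>\<^bsub>M\<^esub>" for d
        by (rule homog[OF F_minus[OF u v(1)]])
      show "g = f"
      proof
        fix d
        have "vec_part d (u - v) = vec_part d u - vec_part d v"
          using u v(1) by (auto simp: vec_part_def free_mod_carrier_iff mon_part_diff intro!: eq_vecI)
        then have "\<epsilon> (vec_part d u) = f d"
          using hom0[of d] diff[OF G_F[OF part_G[OF u]] G_F[OF part_G[OF v(1)]]] by (simp add: f_def)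
        moreover have "vec_part d u = w d"
        proof (rule eq_vecI)
          show "dim_vec (vec_part d u) = dim_vec (w d)"
            using w(1)[of d] by (simp add: vec_part_def u_def graded_free_comp_replicate)
          fix i assume "i < dim_vec (w d)"
          then have i: "i < m" using w(1)[of d] by (simp add: graded_free_comp_replicate)
          have "vec_part d u $ i = (\<Sum>e\<in>?S. mon_part {m. int (monom_degree m) = d} (w e $ i))"
            using i by (simp add: vec_part_def u_def mon_part_sum)
          also have "\<dots> = (\<Sum>e\<in>?S. if e = d then w d $ i else 0)"
          proof (rule sum.cong[OF refl])
            fix e
            have "w e $ i \<in> homog_comp V e"
              using w(1)[of e] i by (simp add: graded_free_comp_replicate)
            then show "mon_part {m. int (monom_degree m) = d} (w e $ i) = (if e = d then w d $ i else 0)"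
              by (auto simp: mon_part_homog_comp)
          qed
          also have "\<dots> = w d $ i"
            using fin w(3)[of d] i by auto
          finally show "vec_part d u $ i = w d $ i" .
        qed
        ultimately show "g d = f d" using w(2) by simp
      qed
    qed
  qed
  show ?thesis
    unfolding graded_module_def using M sub smult decomp by blast
qed

section \<open>The image of the Jacobian matrix\<close>

lemma minor_homog: "minor n r \<in> homog_comp (gvars n) (int n)"
  unfolding minor_eq max_minor_def
  by (rule homog_comp_det)
    (auto simp: gvars_def insert_index_def intro!: homog_comp_mvar)

lemma minor_carrier: "minor n r \<in> carrier (Q_ring n)"
  using homog_comp_carrier[OF minor_homog] by (simp add: Q_ring_def)

lemma J_Q_homog:
  "a < n + 1 \<Longrightarrow> b < n * (n + 1) \<Longrightarrow> J_Q n $$ (a, b) \<in> homog_comp (gvars n) (int n - 1)"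
  unfolding J_Q_def by (simp add: homog_comp_partial_deriv[OF minor_homog])

lemma del2_homog:
  assumes n: "n \<ge> 1" and a: "a < n * (n + 1)" and b: "b < (n - 1) * (n + 1)"
  shows "del2 n $$ (a, b) \<in> homog_comp (gvars n) 1"
proof -
  obtain k j where k: "k < n" and j: "j < n + 1" and a_eq: "a = k * (n + 1) + j"
    using a by (rule block_index_obtain)
  show ?thesis
  proof (cases "b < n * (n - 1)")
    case True
    then obtain k' q where k': "k' < n" and q: "q < n - 1" and b_eq: "b = k' * (n - 1) + q"
      by (rule block_index_obtain)
    show ?thesis
      unfolding a_eq b_eq del2_entry_A[OF k j k' q]
      using k j q by (auto simp: gvars_def insert_index_def intro!: homog_comp_mvar)
  next
    case False
    define q where "q = b - n * (n - 1)"
    have q: "q < n - 1" and b_eq: "b = n * (n - 1) + q"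
      using b False unfolding del2_cols[OF n] q_def by linarith+
    show ?thesis
      unfolding a_eq b_eq del2_entry_B[OF k j q]
      using k j by (auto simp: gvars_def intro!: homog_comp_mvar homog_comp_uminus)
  qed
qed

definition J_image :: "nat \<Rightarrow> 'a::field gpol vec set" where
  "J_image n = (\<lambda>y. J_Q n *\<^sub>v y) ` carrier (free_mod (Q_ring n) (n * (n + 1)))"

lemma J_Q_mult_closed:
  assumes y: "y \<in> carrier (free_mod (Q_ring n) (n * (n + 1)))"
  shows "J_Q n *\<^sub>v y \<in> carrier (free_mod (Q_ring n) (n + 1))"
proof -
  have "(\<Sum>c<n * (n + 1). J_Q n $$ (r, c) * y $ c) \<in> carrier (Q_ring n)" if "r < n + 1" for r
    unfolding Q_ring_def
  proof (intro mpol_carrier_sum mpol_carrier_mult)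
    fix c assume c: "c \<in> {..<n * (n + 1)}"
    show "J_Q n $$ (r, c) \<in> carrier (mpol_ring (gvars n))"
      using J_Q_homog[OF that] c by (intro homog_comp_carrier) simp
    show "y $ c \<in> carrier (mpol_ring (gvars n))"
      using y c by (simp add: free_mod_carrier_iff Q_ring_def)
  qed
  then show ?thesis
    using y J_Q_carrier[of n, where 'a = 'a]
    by (simp add: free_mod_carrier_iff scalar_prod_def atLeast0LessThan del: mult_Suc_right)
qed

lemma J_image_closed: "v \<in> J_image n \<Longrightarrow> v \<in> carrier (free_mod (Q_ring n) (n + 1))"
  unfolding J_image_def using J_Q_mult_closed by blast

text \<open>Vectors in the image are exhibited as derivatives of the minors in a direction \<open>Y\<close>.\<close>

lemma J_imageI:
  fixes v :: "'a::field gpol vec"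
  assumes Y: "\<And>k j. k < n \<Longrightarrow> j < n + 1 \<Longrightarrow> Y k j \<in> carrier (Q_ring n)"
    and dim: "dim_vec v = n + 1"
    and v: "\<And>r. r < n + 1 \<Longrightarrow> v $ r = dmax_minor n X_fun Y r"
  shows "v \<in> J_image n"
proof -
  define y where "y = vec (n * (n + 1)) (\<lambda>c. Y (c div (n + 1)) (c mod (n + 1)))"
  have y_idx: "y $ (k * (n + 1) + j) = Y k j" if "k < n" "j < n + 1" for k j
    unfolding y_def index_vec[OF block_index_less[OF that]] block_index_div_mod[OF that(2)] ..
  have "y \<in> carrier (free_mod (Q_ring n) (n * (n + 1)))"
    unfolding free_mod_carrier_iff
  proof (intro conjI allI impI)
    fix c assume "c < n * (n + 1)"
    then obtain k j where "k < n" "j < n + 1" "c = k * (n + 1) + j" by (rule block_index_obtain)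
    then show "y $ c \<in> carrier (Q_ring n)" using Y y_idx by simp
  qed (simp add: y_def)
  moreover have "J_Q n *\<^sub>v y = v"
  proof (rule eq_vecI)
    fix r assume "r < dim_vec v"
    then have r: "r < n + 1" using dim by simp
    have "(J_Q n *\<^sub>v y) $ r = dmax_minor n X_fun (\<lambda>k j. y $ (k * (n + 1) + j)) r"
      by (rule J_Q_mult_vec[OF _ r]) (simp add: y_def)
    also have "\<dots> = dmax_minor n X_fun Y r" by (rule dmax_minor_cong) (rule y_idx)
    finally show "(J_Q n *\<^sub>v y) $ r = v $ r" using v[OF r] by simp
  qed (simp add: dim J_Q_def)
  ultimately show ?thesis unfolding J_image_def by blast
qed

lemma free_mod_carrier_vec: "v \<in> carrier (free_mod A m) \<Longrightarrow> v \<in> carrier_vec m"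
  by (simp add: free_mod_def)

lemma free_mod_Q_closed:
  fixes v w :: "'a::field gpol vec"
  assumes v: "v \<in> carrier (free_mod (Q_ring n) m)"
  shows "w \<in> carrier (free_mod (Q_ring n) m) \<Longrightarrow> v + w \<in> carrier (free_mod (Q_ring n) m)"
    and "q \<in> carrier (Q_ring n) \<Longrightarrow> q \<cdot>\<^sub>v v \<in> carrier (free_mod (Q_ring n) m)"
  using v by (auto simp: free_mod_carrier_iff Q_ring_def)

lemma J_image_add:
  assumes "v \<in> J_image n" "w \<in> J_image n"
  shows "v + w \<in> J_image n"
proof -
  obtain x y where xy: "x \<in> carrier (free_mod (Q_ring n) (n * (n + 1)))" "v = J_Q n *\<^sub>v x"
    "y \<in> carrier (free_mod (Q_ring n) (n * (n + 1)))" "w = J_Q n *\<^sub>v y"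
    using assms unfolding J_image_def by blast
  have "v + w = J_Q n *\<^sub>v (x + y)"
    unfolding xy(2,4)
    by (rule mult_add_distrib_mat_vec[symmetric, OF J_Q_carrier])
      (use xy(1,3) in \<open>simp_all only: free_mod_carrier_vec\<close>)
  moreover have "x + y \<in> carrier (free_mod (Q_ring n) (n * (n + 1)))"
    using xy(1,3) by (rule free_mod_Q_closed(1))
  ultimately show ?thesis unfolding J_image_def by blast
qed

lemma J_image_smult:
  assumes "v \<in> J_image n" "q \<in> carrier (Q_ring n)"
  shows "q \<cdot>\<^sub>v v \<in> J_image n"
proof -
  obtain x where x: "x \<in> carrier (free_mod (Q_ring n) (n * (n + 1)))" "v = J_Q n *\<^sub>v x"
    using assms unfolding J_image_def by blast
  have "q \<cdot>\<^sub>v v = J_Q n *\<^sub>v (q \<cdot>\<^sub>v x)"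
  proof (rule eq_vecI)
    fix r assume "r < dim_vec (J_Q n *\<^sub>v (q \<cdot>\<^sub>v x))"
    then show "(q \<cdot>\<^sub>v v) $ r = (J_Q n *\<^sub>v (q \<cdot>\<^sub>v x)) $ r"
      using free_mod_carrier_vec[OF x(1)]
      by (simp add: x(2) scalar_prod_def sum_distrib_left mult.left_commute del: mult_Suc_right)
  qed (simp add: x(2))
  moreover have "q \<cdot>\<^sub>v x \<in> carrier (free_mod (Q_ring n) (n * (n + 1)))"
    using x(1) assms(2) by (rule free_mod_Q_closed(2))
  ultimately show ?thesis unfolding J_image_def by blast
qed

lemma J_image_zero: "0\<^sub>v (n + 1) \<in> J_image n"
proof -
  have "0\<^sub>v (n + 1) = J_Q n *\<^sub>v 0\<^sub>v (n * (n + 1))"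
    using J_Q_carrier by (intro eq_vecI) (auto simp: J_Q_def)
  moreover have "0\<^sub>v (n * (n + 1)) \<in> carrier (free_mod (Q_ring n) (n * (n + 1)))"
    by (simp add: free_mod_carrier_iff Q_ring_def del: mult_Suc_right)
  ultimately show ?thesis unfolding J_image_def by blast
qed

definition axis_vec :: "nat \<Rightarrow> nat \<Rightarrow> 'a::zero \<Rightarrow> 'a vec" where
  "axis_vec m j q = vec m (\<lambda>r. if r = j then q else 0)"

lemma X_fun_carrier: "k < n \<Longrightarrow> j < n + 1 \<Longrightarrow> X_fun k j \<in> carrier (Q_ring n)"
  unfolding Q_ring_def by (rule mpol_carrier_mvar) (simp add: gvars_def)

text \<open>Euler's formula for the first row: the direction is the row itself, or \<open>M X\<close> with \<open>M\<close> the matrix whose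
  only nonzero entry is a \<open>1\<close> in the top left corner.\<close>

lemma minors_in_J_image:
  assumes n: "n \<ge> 1"
  shows "vec (n + 1) (minor n) \<in> (J_image n :: 'a::field gpol vec set)"
proof (rule J_imageI)
  let ?M = "\<lambda>k l. if k = 0 \<and> l = 0 then 1 else 0 :: 'a gpol"
  fix r assume r: "r < n + 1"
  have "(\<Sum>k<n. ?M k k) = 1" using n by simp
  then show "vec (n + 1) (minor n) $ r = dmax_minor n X_fun (\<lambda>k j. \<Sum>l<n. ?M k l * X_fun l j) r"
    using r dmax_minor_row_combination[OF r, where X = X_fun and M = ?M] by (simp add: minor_eq)
next
  fix k j assume "k < n" "j < n + 1"
  then show "(\<Sum>l<n. (if k = 0 \<and> l = 0 then 1 else 0) * X_fun l j) \<in> carrier (Q_ring n)"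
    using X_fun_carrier unfolding Q_ring_def by (intro mpol_carrier_sum mpol_carrier_mult) auto
qed simp

text \<open>Shifting column \<open>j\<close> of \<open>X\<close> to column \<open>i\<close> gives \<open>F\<^sub>i e\<^sub>j\<close> up to sign when \<open>i \<noteq> j\<close>. For \<open>i = j\<close> it gives
  \<open>(F\<^sub>0, \<dots>, F\<^sub>n) - F\<^sub>j e\<^sub>j\<close>, and the first vector is in the image as well.\<close>

lemma minor_axis_in_J_image:
  assumes n: "n \<ge> 1" and i: "i < n + 1" and j: "j < n + 1"
  shows "axis_vec (n + 1) j (minor n i) \<in> (J_image n :: 'a::field gpol vec set)"
proof -
  define s where "s = vec (n + 1) (\<lambda>r. (if i = j then minor n r else 0) -
    (if r = j then (-1) ^ (r + i) * minor n i else 0) :: 'a gpol)"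
  have s: "s \<in> J_image n"
  proof (rule J_imageI)
    show "s $ r = dmax_minor n X_fun (\<lambda>k m. if m = i then X_fun k j else 0) r" if "r < n + 1" for r
      using that dmax_minor_column_shift[OF i j that, where X = "X_fun :: nat \<Rightarrow> nat \<Rightarrow> 'a gpol"]
      by (simp add: s_def minor_eq)
    show "(if m = i then X_fun k j else 0 :: 'a gpol) \<in> carrier (Q_ring n)" if "k < n" "m < n + 1" for k m
      using X_fun_carrier[OF that(1) j, where 'a = 'a] by (simp add: Q_ring_def)
  qed (simp add: s_def)
  show ?thesis
  proof (cases "i = j")
    case True
    have "axis_vec (n + 1) j (minor n i) = vec (n + 1) (minor n) + (-1) \<cdot>\<^sub>v s"
      by (rule eq_vecI) (auto simp: axis_vec_def s_def True simp flip: mult_2)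
    moreover have "(-1) \<cdot>\<^sub>v s \<in> J_image n"
      by (rule J_image_smult[OF s]) (simp add: Q_ring_def)
    ultimately show ?thesis using J_image_add[OF minors_in_J_image[OF n]] by metis
  next
    case False
    have "axis_vec (n + 1) j (minor n i) = (- ((-1) ^ (j + i))) \<cdot>\<^sub>v s"
      using False by (intro eq_vecI) (auto simp: axis_vec_def s_def simp flip: mult.assoc power_add mult_2)
    moreover have "(- ((-1) ^ (j + i))) \<cdot>\<^sub>v s \<in> J_image n"
      unfolding Q_ring_def by (rule J_image_smult[OF s]) (auto simp: Q_ring_def)
    ultimately show ?thesis by metis
  qed
qed

lemma cring_Q_ring: "cring (Q_ring n)"
  unfolding Q_ring_def by (rule cring_mpol_ring)

lemma I_ideal_ideal: "ideal (I_ideal n) (Q_ring n)"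
  unfolding I_ideal_def using minor_carrier
  by (intro ring.genideal_ideal cring.axioms(1) cring_Q_ring) auto

lemma Q_ring_simps [simp]:
  "monoid.mult (Q_ring n) = (*)" "one (Q_ring n) = 1" "zero (Q_ring n) = 0" "add (Q_ring n) = (+)"
  by (simp_all add: Q_ring_def)

lemma Q_ring_closed [intro]:
  "p \<in> carrier (Q_ring n) \<Longrightarrow> q \<in> carrier (Q_ring n) \<Longrightarrow> p + q \<in> carrier (Q_ring n)"
  "p \<in> carrier (Q_ring n) \<Longrightarrow> q \<in> carrier (Q_ring n) \<Longrightarrow> p * q \<in> carrier (Q_ring n)"
  "p \<in> carrier (Q_ring n) \<Longrightarrow> - p \<in> carrier (Q_ring n)"
  "0 \<in> carrier (Q_ring n)" "1 \<in> carrier (Q_ring n)"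
  by (auto simp: Q_ring_def)

lemma Q_ring_a_inv: "p \<in> carrier (Q_ring n) \<Longrightarrow> \<ominus>\<^bsub>Q_ring n\<^esub> p = - p"
proof -
  assume p: "p \<in> carrier (Q_ring n)"
  interpret Q: cring "Q_ring n" by (rule cring_Q_ring)
  show ?thesis using p by (intro Q.minus_equality) auto
qed

text \<open>For fixed \<open>j\<close>, the polynomials \<open>q\<close> with \<open>q e\<^sub>j\<close> in the image form an ideal, and it contains the minors.\<close>

lemma I_ideal_axis_in_J_image:
  assumes n: "n \<ge> 1" and j: "j < n + 1" and q: "q \<in> (I_ideal n :: 'a::field gpol set)"
  shows "axis_vec (n + 1) j q \<in> J_image n"
proof -
  interpret Q: cring "Q_ring n :: 'a gpol ring" by (rule cring_Q_ring)
  let ?K = "{q \<in> carrier (Q_ring n). axis_vec (n + 1) j q \<in> J_image n} :: 'a gpol set"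
  have smult: "axis_vec (n + 1) j (p * q) \<in> J_image n"
    if "p \<in> carrier (Q_ring n)" "axis_vec (n + 1) j q \<in> J_image n" for p q :: "'a gpol"
  proof -
    have "axis_vec (n + 1) j (p * q) = p \<cdot>\<^sub>v axis_vec (n + 1) j q"
      by (rule eq_vecI) (auto simp: axis_vec_def)
    then show ?thesis using J_image_smult that by metis
  qed
  have "ideal ?K (Q_ring n)"
  proof (rule idealI)
    show "subgroup ?K (add_monoid (Q_ring n))"
    proof (rule Q.add.subgroupI)
      have "axis_vec (n + 1) j 0 = (0\<^sub>v (n + 1) :: 'a gpol vec)"
        by (rule eq_vecI) (auto simp: axis_vec_def)
      then have "0 \<in> ?K" using J_image_zero[of n, where 'a = 'a] by (simp add: Q_ring_closed(4))
      then show "?K \<noteq> {}" by blast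
      show "\<ominus>\<^bsub>Q_ring n\<^esub> p \<in> ?K" if "p \<in> ?K" for p
        using that smult[of "- 1" p] Q_ring_closed(3)[OF Q_ring_closed(5)] by (auto simp: Q_ring_a_inv)
      show "p \<oplus>\<^bsub>Q_ring n\<^esub> q \<in> ?K" if "p \<in> ?K" "q \<in> ?K" for p q
      proof -
        have "axis_vec (n + 1) j (p + q) = axis_vec (n + 1) j p + axis_vec (n + 1) j q"
          by (rule eq_vecI) (auto simp: axis_vec_def)
        then show ?thesis using that J_image_add by auto
      qed
    qed auto
    show "x \<otimes>\<^bsub>Q_ring n\<^esub> a \<in> ?K" if "a \<in> ?K" "x \<in> carrier (Q_ring n)" for a x
      using that smult by auto
    show "a \<otimes>\<^bsub>Q_ring n\<^esub> x \<in> ?K" if "a \<in> ?K" "x \<in> carrier (Q_ring n)" for a x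
      using that smult by (auto simp: mult.commute[of a x])
  qed (rule Q.ring_axioms)
  moreover have "minor n ` {..<n + 1} \<subseteq> ?K"
    using minor_axis_in_J_image[OF n _ j] minor_carrier by auto
  ultimately have "I_ideal n \<subseteq> ?K"
    unfolding I_ideal_def by (rule Q.genideal_minimal)
  then show ?thesis using q by blast
qed

lemma I_ideal_vec_in_J_image:
  fixes v :: "'a::field gpol vec"
  assumes n: "n \<ge> 1" and dim: "dim_vec v = n + 1" and v: "\<And>i. i < n + 1 \<Longrightarrow> v $ i \<in> I_ideal n"
  shows "v \<in> J_image n"
proof -
  have *: "vec (n + 1) (\<lambda>r. if r < k then v $ r else 0) \<in> J_image n" if "k \<le> n + 1" for k
    using that
  proof (induction k)
    case 0
    have "vec (n + 1) (\<lambda>r. if r < 0 then v $ r else 0) = 0\<^sub>v (n + 1)" by (rule eq_vecI) auto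
    then show ?case by (simp only: J_image_zero)
  next
    case (Suc k)
    have "vec (n + 1) (\<lambda>r. if r < Suc k then v $ r else 0) =
        vec (n + 1) (\<lambda>r. if r < k then v $ r else 0) + axis_vec (n + 1) k (v $ k)"
      by (rule eq_vecI) (auto simp: axis_vec_def less_Suc_eq)
    moreover have "axis_vec (n + 1) k (v $ k) \<in> J_image n"
      by (rule I_ideal_axis_in_J_image[OF n _ v]) (use Suc.prems in auto)
    moreover have "vec (n + 1) (\<lambda>r. if r < k then v $ r else 0) \<in> J_image n"
      by (rule Suc.IH) (use Suc.prems in simp)
    ultimately show ?case by (simp only: J_image_add)
  qed
  have "vec (n + 1) (\<lambda>r. if r < n + 1 then v $ r else 0) = v"
    using dim by (intro eq_vecI) auto
  then show ?thesis using *[OF order_refl] by (simp only:)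
qed

section \<open>Exactness over the polynomial ring\<close>

lemma del2_mult_closed:
  fixes z :: "'a::field gpol vec"
  assumes n: "n \<ge> 1" and z: "z \<in> carrier (free_mod (Q_ring n) ((n - 1) * (n + 1)))"
  shows "del2 n *\<^sub>v z \<in> carrier (free_mod (Q_ring n) (n * (n + 1)))"
proof -
  have D: "dim_row (del2 n :: 'a gpol mat) = n * (n + 1)" "dim_col (del2 n :: 'a gpol mat) = (n - 1) * (n + 1)"
    using del2_carrier[OF n, where 'a = 'a] by auto
  have "(\<Sum>c<(n - 1) * (n + 1). del2 n $$ (a, c) * z $ c) \<in> carrier (Q_ring n)" if a: "a < n * (n + 1)" for a
    unfolding Q_ring_def
  proof (intro mpol_carrier_sum mpol_carrier_mult)
    fix c assume c: "c \<in> {..<(n - 1) * (n + 1)}"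
    show "del2 n $$ (a, c) \<in> carrier (mpol_ring (gvars n))"
      using del2_homog[OF n a] c by (intro homog_comp_carrier) blast
    show "z $ c \<in> carrier (mpol_ring (gvars n))"
      using z c by (simp add: free_mod_carrier_iff Q_ring_def)
  qed
  then show ?thesis
    using z D by (simp add: free_mod_carrier_iff scalar_prod_def atLeast0LessThan del: mult_Suc_right)
qed

text \<open>Both inclusions rest on the derivative of the minors in a direction \<open>M X\<close>: it vanishes when \<open>M\<close> has
  trace zero, and all directions in which it vanishes are of this form.\<close>

lemma J_Q_kernel:
  assumes n: "n \<ge> 1"
  shows "{y \<in> carrier (free_mod (Q_ring n) (n * (n + 1))). J_Q n *\<^sub>v y = 0\<^sub>v (n + 1)} =
    (\<lambda>z. del2 n *\<^sub>v z) ` carrier (free_mod (Q_ring n :: 'a::field gpol ring) ((n - 1) * (n + 1)))"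
proof (intro equalityI subsetI)
  fix y :: "'a gpol vec"
  assume y: "y \<in> {y \<in> carrier (free_mod (Q_ring n) (n * (n + 1))). J_Q n *\<^sub>v y = 0\<^sub>v (n + 1)}"
  let ?Y = "\<lambda>k j. y $ (k * (n + 1) + j)"
  have y_dim: "y \<in> carrier_vec (n * (n + 1))" using y by (blast intro: free_mod_carrier_vec)
  have zero: "dmax_minor n X_fun ?Y r = 0" if "r < n + 1" for r
    using J_Q_mult_vec[OF y_dim that] y that by simp
  have Y_closed: "?Y k j \<in> carrier (Q_ring n)" if "k < n" "j < n + 1" for k j
    using y block_index_less[OF that] by (simp add: free_mod_carrier_iff)
  obtain M where M: "\<And>k l. M k l \<in> carrier (Q_ring n)"
    and YM: "\<And>k j. k < n \<Longrightarrow> j < n + 1 \<Longrightarrow> ?Y k j = (\<Sum>l<n. M k l * X_fun l j)"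
    and tr: "(\<Sum>k<n. M k k) = 0"
    using dmax_minor_kernel[of n ?Y, OF zero Y_closed] by blast
  obtain z where z: "z \<in> carrier_vec ((n - 1) * (n + 1))"
    and zM: "\<And>c. c < (n - 1) * (n + 1) \<Longrightarrow> \<exists>k l. z $ c = M k l"
    and tz: "\<And>k l. k < n \<Longrightarrow> l < n \<Longrightarrow> trace_free_matrix n z k l = M k l"
    using trace_free_matrix_surj[of n M, OF n tr] by blast
  have "y = del2 n *\<^sub>v z"
  proof (rule eq_vecI)
    show "dim_vec y = dim_vec (del2 n *\<^sub>v z)"
      using y_dim del2_carrier[OF n, where 'a = 'a] by simp
    fix c assume "c < dim_vec (del2 n *\<^sub>v z)"
    then have "c < n * (n + 1)" using del2_carrier[OF n, where 'a = 'a] by simp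
    then obtain k j where kj: "k < n" "j < n + 1" "c = k * (n + 1) + j" by (rule block_index_obtain)
    show "y $ c = (del2 n *\<^sub>v z) $ c"
      unfolding kj(3) del2_mult_vec[OF n z kj(1,2)] YM[OF kj(1,2)]
      by (rule sum.cong) (use kj tz in auto)
  qed
  moreover have "z \<in> carrier (free_mod (Q_ring n) ((n - 1) * (n + 1)))"
    unfolding free_mod_carrier_iff using z zM M by (metis carrier_vecD)
  ultimately show "y \<in> (\<lambda>z. del2 n *\<^sub>v z) ` carrier (free_mod (Q_ring n) ((n - 1) * (n + 1)))" by blast
next
  fix y assume "y \<in> (\<lambda>z. del2 n *\<^sub>v z) ` carrier (free_mod (Q_ring n :: 'a gpol ring) ((n - 1) * (n + 1)))"
  then obtain z where z: "z \<in> carrier (free_mod (Q_ring n) ((n - 1) * (n + 1)))" "y = del2 n *\<^sub>v z" by blast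
  have z_dim: "z \<in> carrier_vec ((n - 1) * (n + 1))"
    using z(1) by (rule free_mod_carrier_vec)
  have y: "y \<in> carrier (free_mod (Q_ring n) (n * (n + 1)))" unfolding z(2) by (rule del2_mult_closed[OF n z(1)])
  have y_dim: "y \<in> carrier_vec (n * (n + 1))" using y by (blast intro: free_mod_carrier_vec)
  have "J_Q n *\<^sub>v y = 0\<^sub>v (n + 1)"
  proof (rule eq_vecI)
    fix r assume "r < dim_vec (0\<^sub>v (n + 1) :: 'a gpol vec)"
    then have r: "r < n + 1" by simp
    have "(J_Q n *\<^sub>v y) $ r = dmax_minor n X_fun (\<lambda>k j. y $ (k * (n + 1) + j)) r"
      by (rule J_Q_mult_vec[OF y_dim r])
    also have "\<dots> = dmax_minor n X_fun (\<lambda>k j. \<Sum>l<n. trace_free_matrix n z k l * X_fun l j) r"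
      unfolding z(2) by (rule dmax_minor_cong) (rule del2_mult_vec[OF n z_dim])
    also have "\<dots> = 0"
      unfolding dmax_minor_row_combination[OF r] trace_free_matrix_trace[OF n] by simp
    finally show "(J_Q n *\<^sub>v y) $ r = 0\<^sub>v (n + 1) $ r" using r by simp
  qed (simp add: J_Q_def)
  then show "y \<in> {y \<in> carrier (free_mod (Q_ring n) (n * (n + 1))). J_Q n *\<^sub>v y = 0\<^sub>v (n + 1)}"
    using y by simp
qed

lemma del2_kernel:
  assumes n: "n \<ge> 1"
  shows "{z \<in> carrier (free_mod (Q_ring n :: 'a::field gpol ring) ((n - 1) * (n + 1))).
    del2 n *\<^sub>v z = 0\<^sub>v (n * (n + 1))} = {0\<^sub>v ((n - 1) * (n + 1))}"
proof (intro equalityI subsetI)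
  fix z :: "'a gpol vec"
  assume z: "z \<in> {z \<in> carrier (free_mod (Q_ring n) ((n - 1) * (n + 1))). del2 n *\<^sub>v z = 0\<^sub>v (n * (n + 1))}"
  then have z_dim: "z \<in> carrier_vec ((n - 1) * (n + 1))"
    by (blast intro: free_mod_carrier_vec)
  have "trace_free_matrix n z k l = 0" if kl: "k < n" "l < n" for k l
  proof (rule row_relation_trivial[OF _ kl(2)])
    fix j assume j: "j < n + 1"
    show "(\<Sum>l<n. trace_free_matrix n z k l * X_fun l j) = 0"
      using z block_index_less[OF kl(1) j] unfolding del2_mult_vec[OF n z_dim kl(1) j, symmetric] by simp
  qed
  then show "z \<in> {0\<^sub>v ((n - 1) * (n + 1))}"
    using trace_free_matrix_eq_zero[OF z_dim n] by simp
next
  fix z :: "'a gpol vec" assume "z \<in> {0\<^sub>v ((n - 1) * (n + 1))}"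
  then have z: "z = 0\<^sub>v ((n - 1) * (n + 1))" by simp
  have "del2 n *\<^sub>v z = 0\<^sub>v (n * (n + 1))"
    unfolding z using del2_carrier[OF n, where 'a = 'a] by (intro eq_vecI) auto
  moreover have "z \<in> carrier (free_mod (Q_ring n) ((n - 1) * (n + 1)))"
    unfolding z free_mod_carrier_iff by (auto simp: Q_ring_def)
  ultimately show "z \<in> {z \<in> carrier (free_mod (Q_ring n) ((n - 1) * (n + 1))). del2 n *\<^sub>v z = 0\<^sub>v (n * (n + 1))}"
    by blast
qed

text \<open>The entries of the Jacobian matrix have the common degree \<open>n - 1\<close>, so the component of degree \<open>d\<close> of
  \<open>J\<^sub>Q y\<close> is \<open>J\<^sub>Q\<close> applied to the component of degree \<open>d - (n - 1)\<close> of \<open>y\<close>.\<close>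

lemma J_image_homogeneous:
  fixes v :: "'a::field gpol vec"
  assumes "v \<in> J_image n"
  shows "vec_part d v \<in> J_image n"
proof -
  obtain y where y: "y \<in> carrier (free_mod (Q_ring n) (n * (n + 1)))" and v: "v = J_Q n *\<^sub>v y"
    using assms unfolding J_image_def by blast
  have dims: "dim_vec y = n * (n + 1)" "dim_row (J_Q n :: 'a gpol mat) = n + 1"
    "dim_col (J_Q n :: 'a gpol mat) = n * (n + 1)"
    using y by (simp_all add: free_mod_carrier_iff J_Q_def)
  have "vec_part d v = J_Q n *\<^sub>v vec_part (d - (int n - 1)) y"
  proof (rule eq_vecI)
    fix r assume "r < dim_vec (J_Q n *\<^sub>v vec_part (d - (int n - 1)) y)"
    then have r: "r < n + 1" using dims by simp
    have "vec_part d v $ r =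
        (\<Sum>c<n * (n + 1). mon_part {m. int (monom_degree m) = d} (J_Q n $$ (r, c) * y $ c))"
      using r dims by (simp add: v vec_part_def scalar_prod_def mon_part_sum atLeast0LessThan del: mult_Suc_right)
    also have "\<dots> = (\<Sum>c<n * (n + 1). J_Q n $$ (r, c) *
        mon_part {m. int (monom_degree m) = d - (int n - 1)} (y $ c))"
      by (intro sum.cong refl mon_part_homog_mult[OF J_Q_homog[OF r]]) simp
    also have "\<dots> = (J_Q n *\<^sub>v vec_part (d - (int n - 1)) y) $ r"
      using r dims by (simp add: vec_part_def scalar_prod_def atLeast0LessThan del: mult_Suc_right)
    finally show "vec_part d v $ r = (J_Q n *\<^sub>v vec_part (d - (int n - 1)) y) $ r" .
  qed (simp add: v vec_part_def)
  moreover have "vec_part (d - (int n - 1)) y \<in> carrier (free_mod (Q_ring n) (n * (n + 1)))"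
    using y by (auto simp: free_mod_carrier_iff vec_part_def Q_ring_def
        intro!: homog_comp_carrier mon_part_in_homog_comp)
  ultimately show ?thesis unfolding J_image_def by blast
qed

section \<open>The cokernel over the determinantal ring\<close>

lemma R_ring_cring: "cring (R_ring n)"
  unfolding R_ring_def by (intro ideal.quotient_is_cring I_ideal_ideal cring_Q_ring)

lemma R_proj_hom: "R_proj n \<in> Ring.ring_hom (Q_ring n :: 'a::field gpol ring) (R_ring n)"
proof -
  have "(R_proj n :: 'a gpol \<Rightarrow> _) = (\<lambda>q. I_ideal n +>\<^bsub>Q_ring n\<^esub> q)"
    by (rule ext) (simp add: R_proj_def)
  then show ?thesis
    unfolding R_ring_def by (simp only: ideal.rcos_ring_hom[OF I_ideal_ideal])
qed

lemma R_ring_carrier: "carrier (R_ring n) = R_proj n ` carrier (Q_ring n)"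
  by (auto simp: R_ring_def FactRing_def A_RCOSETS_def' R_proj_def)

lemma R_proj_eqD:
  fixes p q :: "'a::field gpol"
  assumes "p \<in> carrier (Q_ring n)" "q \<in> carrier (Q_ring n)" "R_proj n p = R_proj n q"
  shows "p - q \<in> I_ideal n"
proof -
  interpret I: ideal "I_ideal n :: 'a gpol set" "Q_ring n" by (rule I_ideal_ideal)
  have "p \<in> I_ideal n +>\<^bsub>Q_ring n\<^esub> q"
    using assms I.a_rcos_self[OF assms(1)] by (simp add: R_proj_def)
  then show ?thesis by (auto simp: a_r_coset_def')
qed

text \<open>Vectors over \<open>R\<close> lift to vectors over \<open>Q\<close>, and multiplication by the matrix commutes with reduction.\<close>

lemma J_R_image:
  "mat_image (R_ring n) (J_R n) = map_vec (R_proj n) ` (J_image n :: 'a::field gpol vec set)"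
proof -
  have carrier: "carrier (free_mod (R_ring n :: 'a gpol set ring) m) = map_vec (R_proj n) ` carrier (free_mod (Q_ring n) m)" for m
    using map_vec_free_mod_surj[OF R_ring_carrier] map_vec_free_mod(1)[OF R_proj_hom] by blast
  have "mat_map (R_ring n) (J_R n) (map_vec (R_proj n) y) = map_vec (R_proj n) (J_Q n *\<^sub>v y)"
    if y: "y \<in> carrier (free_mod (Q_ring n) (n * (n + 1)))" for y :: "'a gpol vec"
  proof -
    have J: "(J_Q n :: 'a gpol mat) $$ (i, j) \<in> carrier (Q_ring n)"
      if "i < dim_row (J_Q n :: 'a gpol mat)" "j < dim_col (J_Q n :: 'a gpol mat)" for i j
      using that homog_comp_carrier[OF J_Q_homog] by (simp add: J_Q_def Q_ring_def)
    have y': "y \<in> carrier (free_mod (Q_ring n) (dim_col (J_Q n :: 'a gpol mat)))"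
      using y by (simp add: J_Q_def)
    have "mat_map (R_ring n) (J_R n) (map_vec (R_proj n) y) =
        map_vec (R_proj n) (mat_map (Q_ring n) (J_Q n) y)"
      unfolding J_R_def by (rule mat_map_hom[OF cring_Q_ring R_ring_cring R_proj_hom J y'])
    also have "mat_map (Q_ring n) (J_Q n) y = J_Q n *\<^sub>v y"
      using J y' unfolding Q_ring_def by (rule mat_map_mpol_ring)
    finally show ?thesis .
  qed
  moreover have "dim_col (J_R n :: 'a gpol set mat) = n * (n + 1)" by (simp add: J_R_def J_Q_def)
  ultimately show ?thesis
    unfolding mat_image_def J_image_def carrier image_image by (metis (no_types, lifting) image_cong)
qed

lemma free_mod_Q_ops:
  fixes v w :: "'a::field gpol vec"
  assumes "v \<in> carrier (free_mod (Q_ring n) m)"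
  shows "w \<in> carrier (free_mod (Q_ring n) m) \<Longrightarrow> v \<oplus>\<^bsub>free_mod (Q_ring n) m\<^esub> w = v + w"
    and "q \<odot>\<^bsub>free_mod (Q_ring n) m\<^esub> v = q \<cdot>\<^sub>v v"
  using assms by (auto simp: free_mod_carrier_iff intro!: eq_vecI)

lemma free_mod_R_module: "Module.module (R_ring n :: 'a::field gpol set ring) (free_mod (R_ring n) m)"
  by (rule free_mod_module[OF R_ring_cring])

lemma J_R_image_submodule:
  "Module.submodule (mat_image (R_ring n) (J_R n)) (R_ring n :: 'a::field gpol set ring) (free_mod (R_ring n) (n + 1))"
proof -
  interpret R: cring "R_ring n :: 'a gpol set ring" by (rule R_ring_cring)
  interpret F: Module.module "R_ring n :: 'a gpol set ring" "free_mod (R_ring n) (n + 1)"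
    by (rule free_mod_module[OF R_ring_cring])
  let ?\<pi> = "map_vec (R_proj n) :: 'a gpol vec \<Rightarrow> 'a gpol set vec"
  let ?F = "free_mod (R_ring n) (n + 1) :: ('a gpol set, 'a gpol set vec) module"
  have closed: "?\<pi> v \<in> carrier ?F" if "v \<in> J_image n" for v
    by (rule map_vec_free_mod(1)[OF R_proj_hom J_image_closed[OF that]])
  have smult: "a \<odot>\<^bsub>?F\<^esub> x \<in> ?\<pi> ` J_image n" if a: "a \<in> carrier (R_ring n)" and x: "x \<in> ?\<pi> ` J_image n" for a x
  proof -
    obtain q where q: "q \<in> carrier (Q_ring n)" "a = R_proj n q" using a unfolding R_ring_carrier by blast
    obtain v where v: "v \<in> J_image n" "x = ?\<pi> v" using x by blast
    have "a \<odot>\<^bsub>?F\<^esub> x = ?\<pi> (q \<cdot>\<^sub>v v)"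
      unfolding q(2) v(2) map_vec_free_mod(3)[OF R_proj_hom q(1) J_image_closed[OF v(1)], symmetric]
        free_mod_Q_ops(2)[OF J_image_closed[OF v(1)]] ..
    then show ?thesis using J_image_smult[OF v(1) q(1)] by blast
  qed
  show ?thesis
    unfolding J_R_image
  proof (rule F.submoduleI)
    show "?\<pi> ` J_image n \<subseteq> carrier ?F" using closed by blast
    have "\<zero>\<^bsub>R_ring n\<^esub> \<odot>\<^bsub>?F\<^esub> ?\<pi> (0\<^sub>v (n + 1)) \<in> ?\<pi> ` J_image n"
      by (rule smult) (use J_image_zero in auto)
    then show "\<zero>\<^bsub>?F\<^esub> \<in> ?\<pi> ` J_image n"
      using F.smult_l_null[OF closed[OF J_image_zero]] by simp
    show "\<ominus>\<^bsub>?F\<^esub> x \<in> ?\<pi> ` J_image n" if x: "x \<in> ?\<pi> ` J_image n" for x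
    proof -
      have "x \<in> carrier ?F" using x closed by blast
      then have "\<ominus>\<^bsub>?F\<^esub> x = (\<ominus>\<^bsub>R_ring n\<^esub> \<one>\<^bsub>R_ring n\<^esub>) \<odot>\<^bsub>?F\<^esub> x"
        by (simp only: F.smult_l_minus R.one_closed F.smult_one)
      then show ?thesis using smult[OF R.a_inv_closed[OF R.one_closed] x] by simp
    qed
    show "x \<oplus>\<^bsub>?F\<^esub> y \<in> ?\<pi> ` J_image n" if xy: "x \<in> ?\<pi> ` J_image n" "y \<in> ?\<pi> ` J_image n" for x y
    proof -
      obtain v w where v: "v \<in> J_image n" "x = ?\<pi> v" and w: "w \<in> J_image n" "y = ?\<pi> w" using xy by blast
      have "x \<oplus>\<^bsub>?F\<^esub> y = ?\<pi> (v + w)"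
        unfolding v(2) w(2) map_vec_free_mod(2)[OF R_proj_hom J_image_closed[OF v(1)] J_image_closed[OF w(1)], symmetric]
          free_mod_Q_ops(1)[OF J_image_closed[OF v(1)] J_image_closed[OF w(1)]] ..
      then show ?thesis using J_image_add[OF v(1) w(1)] by blast
    qed
  qed (rule smult)
qed

lemma coker_J_R_eq:
  "coker_J_R n = restrict_scalars (R_proj n)
    (quot_mod (free_mod (R_ring n) (n + 1)) (mat_image (R_ring n) (J_R n)))"
  by (simp add: coker_J_R_def coker_def J_R_def J_Q_def)

lemma augmentation_eq:
  "augmentation n v = mat_image (R_ring n) (J_R n) +>\<^bsub>free_mod (R_ring n) (n + 1)\<^esub> map_vec (R_proj n) v"
  by (simp add: augmentation_def coker_proj_def J_R_def J_Q_def)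

lemma coker_J_R_module: "Module.module (Q_ring n) (coker_J_R n)"
  unfolding coker_J_R_eq
  by (rule restrict_scalars_module[OF cring_Q_ring
        quot_mod_module[OF free_mod_R_module J_R_image_submodule] R_proj_hom])

lemma augmentation_hom:
  "augmentation n \<in> LinearCombinations.module_hom (Q_ring n :: 'a::field gpol ring) (free_mod (Q_ring n) (n + 1)) (coker_J_R n)"
proof -
  note FR = free_mod_R_module[of n "n + 1", where 'a = 'a]
  note sub = J_R_image_submodule[of n, where 'a = 'a]
  note \<pi> = map_vec_free_mod[OF R_proj_hom]
  show ?thesis
    unfolding LinearCombinations.module_hom_def
  proof (intro CollectI conjI allI impI Pi_I)
    fix v :: "'a gpol vec" assume v: "v \<in> carrier (free_mod (Q_ring n) (n + 1))"
    show "augmentation n v \<in> carrier (coker_J_R n)"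
      unfolding coker_J_R_eq augmentation_eq restrict_scalars_simps quot_mod_carrier[OF FR sub]
      by (rule imageI[OF \<pi>(1)[OF v]])
  next
    fix v w :: "'a gpol vec"
    assume vw: "v \<in> carrier (free_mod (Q_ring n) (n + 1)) \<and> w \<in> carrier (free_mod (Q_ring n) (n + 1))"
    show "augmentation n (v \<oplus>\<^bsub>free_mod (Q_ring n) (n + 1)\<^esub> w) =
        augmentation n v \<oplus>\<^bsub>coker_J_R n\<^esub> augmentation n w"
      unfolding coker_J_R_eq augmentation_eq restrict_scalars_simps
        \<pi>(2)[OF conjunct1[OF vw] conjunct2[OF vw]]
      by (rule quot_mod_add[OF FR sub, symmetric]) (use vw \<pi>(1) in blast)+
  next
    fix q :: "'a gpol" and v :: "'a gpol vec"
    assume qv: "q \<in> carrier (Q_ring n) \<and> v \<in> carrier (free_mod (Q_ring n) (n + 1))"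
    show "augmentation n (q \<odot>\<^bsub>free_mod (Q_ring n) (n + 1)\<^esub> v) =
        q \<odot>\<^bsub>coker_J_R n\<^esub> augmentation n v"
      unfolding coker_J_R_eq augmentation_eq restrict_scalars_simps
        \<pi>(3)[OF conjunct1[OF qv] conjunct2[OF qv]]
      by (rule quot_mod_smult[OF FR sub, symmetric])
        (use qv \<pi>(1) ring_hom_closed[OF R_proj_hom] in blast)+
  qed
qed

lemma augmentation_surj:
  "augmentation n ` carrier (free_mod (Q_ring n :: 'a::field gpol ring) (n + 1)) = carrier (coker_J_R n)"
proof
  note FR = free_mod_R_module[of n "n + 1", where 'a = 'a]
  note sub = J_R_image_submodule[of n, where 'a = 'a]
  have surj: "carrier (free_mod (R_ring n :: 'a gpol set ring) (n + 1)) \<subseteq>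
      map_vec (R_proj n) ` carrier (free_mod (Q_ring n) (n + 1))"
    by (rule map_vec_free_mod_surj[OF R_ring_carrier])
  show "augmentation n ` carrier (free_mod (Q_ring n :: 'a gpol ring) (n + 1)) \<subseteq> carrier (coker_J_R n)"
    using LinearCombinations.module_hom_closed[OF augmentation_hom] by blast
  show "carrier (coker_J_R n) \<subseteq> augmentation n ` carrier (free_mod (Q_ring n :: 'a gpol ring) (n + 1))"
    unfolding coker_J_R_eq augmentation_eq restrict_scalars_simps quot_mod_carrier[OF FR sub]
    using surj by blast
qed

text \<open>A vector in the kernel agrees modulo \<open>I\<^sub>n\<close> with an element of the image of \<open>J\<^sub>Q\<close>, and vectors with
  entries in \<open>I\<^sub>n\<close> are in that image anyway.\<close>

lemma augmentation_eq_zero_iff: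
  fixes v :: "'a::field gpol vec"
  assumes n: "n \<ge> 1" and v: "v \<in> carrier (free_mod (Q_ring n) (n + 1))"
  shows "augmentation n v = \<zero>\<^bsub>coker_J_R n\<^esub> \<longleftrightarrow> v \<in> J_image n"
proof -
  note FR = free_mod_R_module[of n "n + 1", where 'a = 'a]
  note sub = J_R_image_submodule[of n, where 'a = 'a]
  have "augmentation n v = \<zero>\<^bsub>coker_J_R n\<^esub> \<longleftrightarrow> map_vec (R_proj n) v \<in> map_vec (R_proj n) ` J_image n"
    unfolding coker_J_R_eq augmentation_eq restrict_scalars_simps quot_mod_simps
    unfolding quot_mod_eq_zero_iff[OF FR sub map_vec_free_mod(1)[OF R_proj_hom v]]
    unfolding J_R_image ..
  also have "\<dots> \<longleftrightarrow> v \<in> J_image n"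
  proof
    assume "map_vec (R_proj n) v \<in> map_vec (R_proj n) ` J_image n"
    then obtain b where b: "b \<in> J_image n" "map_vec (R_proj n) v = map_vec (R_proj n) b" by blast
    have bF: "b \<in> carrier (free_mod (Q_ring n) (n + 1))" by (rule J_image_closed[OF b(1)])
    have dims: "dim_vec v = n + 1" "dim_vec b = n + 1" using v bF by (simp_all add: free_mod_carrier_iff)
    have "(v - b) $ i \<in> I_ideal n" if "i < n + 1" for i
    proof -
      have "R_proj n (v $ i) = R_proj n (b $ i)"
        using arg_cong[OF b(2), of "\<lambda>u. u $ i"] that dims by simp
      then have "v $ i - b $ i \<in> I_ideal n"
        using v bF that by (intro R_proj_eqD) (simp_all add: free_mod_carrier_iff)
      then show ?thesis using that dims by simp
    qed
    then have "v - b \<in> J_image n" using dims by (intro I_ideal_vec_in_J_image[OF n]) simp_all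
    moreover have "v = (v - b) + b" using dims by (intro eq_vecI) simp_all
    ultimately show "v \<in> J_image n" using J_image_add[OF _ b(1)] by metis
  qed blast
  finally show ?thesis .
qed

lemma coker_J_R_grading_eq:
  "coker_J_R_grading n d = augmentation n ` graded_free_comp (gvars n) (replicate (n + 1) 0) (d::int)"
proof -
  have "{v \<in> carrier (free_mod (R_ring n) (n + 1)). \<forall>i<n + 1. v $ i \<in> R_proj n ` homog_comp (gvars n) d} =
      map_vec (R_proj n) ` (graded_free_comp (gvars n) (replicate (n + 1) 0) d :: 'a::field gpol vec set)"
    (is "?L = ?R")
  proof
    show "?L \<subseteq> ?R"
    proof
      fix v assume v: "v \<in> ?L"
      then have "\<forall>i. \<exists>p. i < n + 1 \<longrightarrow> p \<in> homog_comp (gvars n) d \<and> v $ i = R_proj n p" by blast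
      then obtain p where "\<forall>i. i < n + 1 \<longrightarrow> p i \<in> homog_comp (gvars n) d \<and> v $ i = R_proj n (p i)"
        unfolding choice_iff by blast
      then have p: "\<And>i. i < n + 1 \<Longrightarrow> p i \<in> homog_comp (gvars n) d" "\<And>i. i < n + 1 \<Longrightarrow> v $ i = R_proj n (p i)"
        by blast+
      show "v \<in> ?R"
      proof (rule image_eqI)
        show "v = map_vec (R_proj n) (vec (n + 1) p)"
          by (rule eq_vecI) (use v p(2) in \<open>simp_all add: free_mod_carrier_iff\<close>)
        show "vec (n + 1) p \<in> graded_free_comp (gvars n) (replicate (n + 1) 0) d"
          unfolding graded_free_comp_replicate using p(1) by simp
      qed
    qed
    show "?R \<subseteq> ?L"
    proof
      fix v assume "v \<in> ?R"
      then obtain w where w: "w \<in> graded_free_comp (gvars n) (replicate (n + 1) 0) d" "v = map_vec (R_proj n) w"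
        by blast
      have w': "dim_vec w = n + 1" "\<And>i. i < n + 1 \<Longrightarrow> w $ i \<in> homog_comp (gvars n) d"
        using w(1) unfolding graded_free_comp_replicate by auto
      have "w \<in> carrier (free_mod (Q_ring n) (n + 1))"
        using w' homog_comp_carrier unfolding free_mod_carrier_iff Q_ring_def by blast
      then have "v \<in> carrier (free_mod (R_ring n) (n + 1))"
        unfolding w(2) by (rule map_vec_free_mod(1)[OF R_proj_hom])
      then show "v \<in> ?L" using w' by (auto simp: w(2))
    qed
  qed
  then show ?thesis
    unfolding coker_J_R_grading_def augmentation_def by (simp only: image_image)
qed

section \<open>The minimal resolution\<close>

theorem theorem4p8:
  fixes n :: nat
  assumes "n \<ge> 2"
  shows "minimal_graded_free_resolution (gvars n)
           (coker_J_R n :: ('k::field gpol, 'k gpol set vec set) module) (coker_J_R_grading n)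
           [replicate (n + 1) 0,
            replicate (n * (n + 1)) (int n - 1),
            replicate ((n - 1) * (n + 1)) (int n)]
           [J_Q n, del2 n]
           (augmentation n)"
proof -
  have n: "n \<ge> 1" using assms by simp
  note Q = Q_ring_def[symmetric]
  have hom: "augmentation n \<in> LinearCombinations.module_hom (mpol_ring (gvars n))
      (free_mod (mpol_ring (gvars n)) (n + 1)) (coker_J_R n :: ('k gpol, 'k gpol set vec set) module)"
    unfolding Q by (rule augmentation_hom)
  have kernel: "{v \<in> carrier (free_mod (mpol_ring (gvars n)) (n + 1)). augmentation n v =
      \<zero>\<^bsub>(coker_J_R n :: ('k gpol, 'k gpol set vec set) module)\<^esub>} = J_image n"
    unfolding Q using augmentation_eq_zero_iff[OF n] J_image_closed by blast
  have graded: "graded_module (gvars n) (coker_J_R n :: ('k gpol, 'k gpol set vec set) module) (coker_J_R_grading n)"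
    unfolding coker_J_R_grading_eq
  proof (rule graded_module_image[OF _ hom])
    fix v :: "'k gpol vec" and d
    assume v: "v \<in> carrier (free_mod (mpol_ring (gvars n)) (n + 1))"
      and zero: "augmentation n v = \<zero>\<^bsub>coker_J_R n\<^esub>"
    have "v \<in> J_image n" using v zero kernel by blast
    then have "vec_part d v \<in> J_image n" by (rule J_image_homogeneous)
    then show "augmentation n (vec_part d v) = \<zero>\<^bsub>coker_J_R n\<^esub>" using kernel by blast
  qed (unfold Q, rule coker_J_R_module, rule augmentation_surj)
  have comps: "augmentation n ` graded_free_comp (gvars n) (replicate (n + 1) 0) d \<subseteq>
      (coker_J_R_grading n d :: 'k gpol set vec set set)" for d
    unfolding coker_J_R_grading_eq ..
  have all_less_2: "(\<forall>i<length [a, b]. P i) \<longleftrightarrow> P 0 \<and> P 1" for P and a b :: "'k gpol mat"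
    by (auto simp: less_Suc_eq)
  have J: "(J_Q n :: 'k gpol mat) $$ (a, b) \<in> homog_comp (gvars n) (int n - 1)"
    if "a < n + 1" "b < n * (n + 1)" for a b
    using that by (rule J_Q_homog)
  have D: "(del2 n :: 'k gpol mat) $$ (a, b) \<in> homog_comp (gvars n) 1"
    if "a < n * (n + 1)" "b < (n - 1) * (n + 1)" for a b
    using n that by (rule del2_homog)
  have resolution: "graded_free_resolution (gvars n)
       (coker_J_R n :: ('k gpol, 'k gpol set vec set) module) (coker_J_R_grading n)
       [replicate (n + 1) 0, replicate (n * (n + 1)) (int n - 1), replicate ((n - 1) * (n + 1)) (int n)]
       [J_Q n, del2 n] (augmentation n)"
    unfolding graded_free_resolution_def Let_def all_less_2
    using graded hom comps augmentation_surj[of n, where 'a = 'k, unfolded Q_ring_def] kernel J D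
      J_Q_carrier[of n, where 'a = 'k] del2_carrier[OF n, where 'a = 'k]
      J_Q_kernel[OF n, where 'a = 'k] del2_kernel[OF n, where 'a = 'k]
    by (simp add: J_image_def Q_ring_def del: mult_Suc_right replicate_Suc)
  moreover have "D $$ (a, b) \<in> homog_max_ideal (gvars n)"
    if entry: "D \<in> set [J_Q n, del2 n :: 'k gpol mat]" "a < dim_row D" "b < dim_col D" for D a b
  proof -
    have "D = J_Q n \<or> D = del2 n" using entry(1) by auto
    then show ?thesis
    proof
      assume "D = J_Q n"
      then have "D $$ (a, b) \<in> homog_comp (gvars n) (int n - 1)"
        using J entry(2,3) by (simp add: J_Q_def)
      then show ?thesis by (rule homog_max_idealI) (use assms in simp)
    next
      assume "D = del2 n"
      then have "D $$ (a, b) \<in> homog_comp (gvars n) 1"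
        using D entry(2,3) del2_carrier[OF n, where 'a = 'k] by auto
      then show ?thesis by (rule homog_max_idealI) simp
    qed
  qed
  ultimately show ?thesis unfolding minimal_graded_free_resolution_def by blast
qed

end
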